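(* Let $G$ be a graph, let $k$ be its branch-depth and let $t$ be its tree-depth. Then \[ k-1\le t\le \max(2k^2-k+1,2). \]
   Context: Graphs are finite and may have loops and parallel edges. A connectivity function on a finite set $E$ is a function $\lambda:2^E\to\mathbb{Z}$ with $\lambda(\emptyset)=0$, $\lambda(X)=\lambda(E\setminus X)$ for all $X$, and $\lambda(X)+\lambda(Y)\ge\lambda(X\cup Y)+\lambda(X\cap Y)$ for all $X,Y$. The radius of a tree is the minimum $r$ such that some node has distance at most $r$ from every node. A decomposition of $\lambda$ is a pair $(T,\sigma)$ where $T$ is a tree with at least one internal (non-leaf) node and $\sigma$ is a bijection from $E$ to the set of leaves of $T$; its radius is the radius of $T$. For an internal node $v$, the components of $T-v$ induce (via $\sigma$) a partition $\mathcal P_v$ of $E$, and the width of $v$ is $\max_{\mathcal P'\subseteq\mathcal P_v}\lambda(\bigcup_{X\in\mathcal P'}X)$; the width of $(T,\sigma)$ is the maximum width of an internal node. A $(k,r)$-decomposition is a decomposition of width at most $k$ and radius at most $r$. The branch-depth of $\lambda$ is the minimum $k$ such that $\lambda$ has a $(k,k)$-decomposition; if $|E|<2$ the branch-depth is defined to be $0$. For a graph $G=(V,E)$ and $X\subseteq E$, $\lambda_G(X)$ is the number of vertices incident with both an edge in $X$ and an edge in $E\setminus X$; the branch-depth of $G$ is the branch-depth of $\lambda_G$. Tree-depth: a rooted forest has a root in each component with edges oriented away from roots; its closure is the simple graph on its vertex set in which two vertices are adjacent iff there is a directed path from one to the other; its height is the number of vertices of a longest directed path. The tree-depth of a simple graph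 $G$ is the minimum height of a rooted forest whose closure contains $G$ as a subgraph; the tree-depth of a general graph is that of its simplification. *)

theory Defs
  imports Main
begin

section \<open>Simple graphs, trees and distances\<close>

text \<open>
  A simple graph is given by its vertex set \<open>V\<close> and a set \<open>F\<close> of two-element subsets of \<open>V\<close>.
  It serves for decomposition trees, rooted forests, their closures and simplifications.
\<close>

definition simple_graph :: "'a set \<Rightarrow> 'a set set \<Rightarrow> bool" where
  "simple_graph V F \<longleftrightarrow> finite V \<and> (\<forall>e\<in>F. e \<subseteq> V \<and> card e = 2)"

definition walk :: "'a set \<Rightarrow> 'a set set \<Rightarrow> 'a list \<Rightarrow> bool" where
  "walk V F p \<longleftrightarrow> p \<noteq> [] \<and> set p \<subseteq> V \<and> successively (\<lambda>u v. {u, v} \<in> F) p"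

definition joined :: "'a set \<Rightarrow> 'a set set \<Rightarrow> 'a \<Rightarrow> 'a \<Rightarrow> bool" where
  "joined V F u v \<longleftrightarrow> (\<exists>p. walk V F p \<and> hd p = u \<and> last p = v)"

definition components :: "'a set \<Rightarrow> 'a set set \<Rightarrow> 'a set set" where
  "components V F = (\<lambda>u. {v. joined V F u v}) ` V"

definition is_cycle :: "'a set \<Rightarrow> 'a set set \<Rightarrow> 'a list \<Rightarrow> bool" where
  "is_cycle V F p \<longleftrightarrow> walk V F p \<and> distinct p \<and> 3 \<le> length p \<and> {last p, hd p} \<in> F"

definition forest :: "'a set \<Rightarrow> 'a set set \<Rightarrow> bool" where
  "forest V F \<longleftrightarrow> simple_graph V F \<and> \<not> (\<exists>p. is_cycle V F p)"

definition tree :: "'a set \<Rightarrow> 'a set set \<Rightarrow> bool" where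
  "tree V F \<longleftrightarrow> forest V F \<and> V \<noteq> {} \<and> (\<forall>u\<in>V. \<forall>v\<in>V. joined V F u v)"

text \<open>Only meaningful for two vertices of the same component.\<close>

definition distance :: "'a set \<Rightarrow> 'a set set \<Rightarrow> 'a \<Rightarrow> 'a \<Rightarrow> nat" where
  "distance V F u v = (LEAST n. \<exists>p. walk V F p \<and> hd p = u \<and> last p = v \<and> length p = Suc n)"

definition radius :: "'a set \<Rightarrow> 'a set set \<Rightarrow> nat" where
  "radius V F = (LEAST r. \<exists>u\<in>V. \<forall>w\<in>V. distance V F u w \<le> r)"

definition leaves :: "'a set \<Rightarrow> 'a set set \<Rightarrow> 'a set" where
  "leaves V F = {v \<in> V. card {e \<in> F. v \<in> e} = 1}"

definition internal_nodes :: "'a set \<Rightarrow> 'a set set \<Rightarrow> 'a set" where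
  "internal_nodes V F = V - leaves V F"


section \<open>Connectivity functions and branch-depth\<close>

definition connectivity_function :: "'e set \<Rightarrow> ('e set \<Rightarrow> int) \<Rightarrow> bool" where
  "connectivity_function E f \<longleftrightarrow>
     finite E \<and> f {} = 0 \<and> (\<forall>X\<subseteq>E. f X = f (E - X)) \<and>
     (\<forall>X\<subseteq>E. \<forall>Y\<subseteq>E. f X + f Y \<ge> f (X \<union> Y) + f (X \<inter> Y))"

definition decomposition :: "'e set \<Rightarrow> 'n set \<Rightarrow> 'n set set \<Rightarrow> ('e \<Rightarrow> 'n) \<Rightarrow> bool" where
  "decomposition E V F \<sigma> \<longleftrightarrow>
     tree V F \<and> internal_nodes V F \<noteq> {} \<and> bij_betw \<sigma> E (leaves V F)"

definition node_partition ::
    "'e set \<Rightarrow> 'n set \<Rightarrow> 'n set set \<Rightarrow> ('e \<Rightarrow> 'n) \<Rightarrow> 'n \<Rightarrow> 'e set set" where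
  "node_partition E V F \<sigma> v =
     (\<lambda>C. {e \<in> E. \<sigma> e \<in> C}) ` components (V - {v}) {e \<in> F. v \<notin> e}"

definition node_width ::
    "'e set \<Rightarrow> ('e set \<Rightarrow> int) \<Rightarrow> 'n set \<Rightarrow> 'n set set \<Rightarrow> ('e \<Rightarrow> 'n) \<Rightarrow> 'n \<Rightarrow> int" where
  "node_width E f V F \<sigma> v = Max ((\<lambda>P. f (\<Union>P)) ` Pow (node_partition E V F \<sigma> v))"

definition width ::
    "'e set \<Rightarrow> ('e set \<Rightarrow> int) \<Rightarrow> 'n set \<Rightarrow> 'n set set \<Rightarrow> ('e \<Rightarrow> 'n) \<Rightarrow> int" where
  "width E f V F \<sigma> = Max (node_width E f V F \<sigma> ` internal_nodes V F)"

definition kr_decomposition ::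
    "'e set \<Rightarrow> ('e set \<Rightarrow> int) \<Rightarrow> nat \<Rightarrow> nat \<Rightarrow> 'n set \<Rightarrow> 'n set set \<Rightarrow> ('e \<Rightarrow> 'n) \<Rightarrow> bool" where
  "kr_decomposition E f k r V F \<sigma> \<longleftrightarrow>
     decomposition E V F \<sigma> \<and> width E f V F \<sigma> \<le> int k \<and> radius V F \<le> r"

text \<open>
  Trees are finite, so it is no restriction to take natural numbers as nodes of the
  decomposition trees.
\<close>

definition branch_depth :: "'e set \<Rightarrow> ('e set \<Rightarrow> int) \<Rightarrow> nat" where
  "branch_depth E f =
     (if card E < 2 then 0
      else LEAST k. \<exists>(V :: nat set) F \<sigma>. kr_decomposition E f k k V F \<sigma>)"


section \<open>Graphs with loops and parallel edges\<close>

text \<open>Every edge has a set of one or two ends; an edge with a single end is a loop.\<close>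

record ('v, 'e) mgraph =
  verts :: "'v set"
  edges :: "'e set"
  ends :: "'e \<Rightarrow> 'v set"

definition finite_mgraph :: "('v, 'e) mgraph \<Rightarrow> bool" where
  "finite_mgraph G \<longleftrightarrow> finite (verts G) \<and> finite (edges G) \<and>
     (\<forall>e\<in>edges G. ends G e \<subseteq> verts G \<and> card (ends G e) \<in> {1, 2})"

definition graph_connectivity :: "('v, 'e) mgraph \<Rightarrow> 'e set \<Rightarrow> int" where
  "graph_connectivity G X =
     int (card {v \<in> verts G. (\<exists>e\<in>X. v \<in> ends G e) \<and> (\<exists>e\<in>edges G - X. v \<in> ends G e)})"

lemma connectivity_function_graph_connectivity:
  assumes "finite_mgraph G"
  shows "connectivity_function (edges G) (graph_connectivity G)"
proof -
  define B where "B X = {v \<in> verts G. (\<exists>e\<in>X. v \<in> ends G e) \<and> (\<exists>e\<in>edges G - X. v \<in> ends G e)}" for X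
  have fin: "finite (B X)" for X
    using assms by (simp add: B_def finite_mgraph_def)
  have sym: "B X = B (edges G - X)" if "X \<subseteq> edges G" for X
    using that unfolding B_def by blast
  have submod: "card (B (X \<union> Y)) + card (B (X \<inter> Y)) \<le> card (B X) + card (B Y)" for X Y
  proof -
    have u: "B (X \<union> Y) \<union> B (X \<inter> Y) \<subseteq> B X \<union> B Y"
      and i: "B (X \<union> Y) \<inter> B (X \<inter> Y) \<subseteq> B X \<inter> B Y"
      unfolding B_def by blast+
    have "card (B (X \<union> Y)) + card (B (X \<inter> Y))
        = card (B (X \<union> Y) \<union> B (X \<inter> Y)) + card (B (X \<union> Y) \<inter> B (X \<inter> Y))"
      by (rule card_Un_Int[OF fin fin])
    also have "\<dots> \<le> card (B X \<union> B Y) + card (B X \<inter> B Y)"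
    proof (rule add_mono)
      show "card (B (X \<union> Y) \<union> B (X \<inter> Y)) \<le> card (B X \<union> B Y)"
        by (rule card_mono[OF _ u]) (simp add: fin)
      show "card (B (X \<union> Y) \<inter> B (X \<inter> Y)) \<le> card (B X \<inter> B Y)"
        by (rule card_mono[OF _ i]) (simp add: fin)
    qed
    also have "\<dots> = card (B X) + card (B Y)"
      by (rule card_Un_Int[OF fin fin, symmetric])
    finally show ?thesis .
  qed
  have val: "graph_connectivity G X = int (card (B X))" for X
    by (simp add: graph_connectivity_def B_def)
  show ?thesis
    unfolding connectivity_function_def val
  proof (intro conjI allI impI)
    show "finite (edges G)"
      using assms by (simp add: finite_mgraph_def)
    show "int (card (B {})) = 0"
      by (simp add: B_def)
    show "int (card (B X)) = int (card (B (edges G - X)))" if "X \<subseteq> edges G" for X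
      by (rule arg_cong[OF sym[OF that]])
    show "int (card (B (X \<union> Y))) + int (card (B (X \<inter> Y))) \<le> int (card (B X)) + int (card (B Y))"
      for X Y
      using submod[of X Y] by linarith
  qed
qed

definition graph_branch_depth :: "('v, 'e) mgraph \<Rightarrow> nat" where
  "graph_branch_depth G = branch_depth (edges G) (graph_connectivity G)"


section \<open>Rooted forests and tree-depth\<close>

definition rooted_forest :: "'a set \<Rightarrow> 'a set set \<Rightarrow> 'a set \<Rightarrow> bool" where
  "rooted_forest V F R \<longleftrightarrow>
     forest V F \<and> R \<subseteq> V \<and> (\<forall>C\<in>components V F. \<exists>!r. r \<in> R \<and> r \<in> C)"

text \<open>The orientation of the edges away from the roots.\<close>

definition arcs :: "'a set \<Rightarrow> 'a set set \<Rightarrow> 'a set \<Rightarrow> ('a \<times> 'a) set" where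
  "arcs V F R = {(u, v). {u, v} \<in> F \<and>
     (\<exists>r\<in>R. joined V F r u \<and> distance V F r v = Suc (distance V F r u))}"

definition directed_path :: "'a set \<Rightarrow> 'a set set \<Rightarrow> 'a set \<Rightarrow> 'a list \<Rightarrow> bool" where
  "directed_path V F R p \<longleftrightarrow>
     p \<noteq> [] \<and> set p \<subseteq> V \<and> distinct p \<and> successively (\<lambda>u v. (u, v) \<in> arcs V F R) p"

definition closure_edges :: "'a set \<Rightarrow> 'a set set \<Rightarrow> 'a set \<Rightarrow> 'a set set" where
  "closure_edges V F R =
     {{u, v} |u v. u \<noteq> v \<and> (\<exists>p. directed_path V F R p \<and> hd p = u \<and> last p = v)}"

text \<open>The inserted \<open>0\<close> matters only for the empty forest, which has height \<open>0\<close>.\<close>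

definition height :: "'a set \<Rightarrow> 'a set set \<Rightarrow> 'a set \<Rightarrow> nat" where
  "height V F R = Max (insert 0 (length ` {p. directed_path V F R p}))"

text \<open>
  The rooted forest may have vertices outside \<open>V\<close>. Restricting them to the vertex type of the
  graph does not change the minimum: deleting a vertex and attaching its children to its parent
  preserves the ancestor relation on the remaining vertices and does not increase the height,
  so an optimal forest with vertex set \<open>V\<close> exists.
\<close>

definition simple_tree_depth :: "'a set \<Rightarrow> 'a set set \<Rightarrow> nat" where
  "simple_tree_depth V F =
     (LEAST h. \<exists>W D R. rooted_forest W D R \<and> V \<subseteq> W \<and> F \<subseteq> closure_edges W D R \<and> height W D R = h)"

definition simplification_edges :: "('v, 'e) mgraph \<Rightarrow> 'v set set" where
  "simplification_edges G = {ends G e |e. e \<in> edges G \<and> card (ends G e) = 2}"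

definition graph_tree_depth :: "('v, 'e) mgraph \<Rightarrow> nat" where
  "graph_tree_depth G = simple_tree_depth (verts G) (simplification_edges G)"

end

theory Submission imports Defs begin

text \<open>
  Lower bound: take an optimal rooted forest, join its roots to a new node and hang every edge of
  \<open>G\<close> as a leaf below its lower end. A vertex on the boundary of a union of parts at a node \<open>x\<close>
  is an ancestor of \<open>x\<close>, so the width is at most the tree-depth \<open>t\<close>, and the radius is at
  most \<open>t + 1\<close>.

  Upper bound: root a \<open>(k, k)\<close>-decomposition at an internal centre and place each vertex of \<open>G\<close>
  at the deepest node below which all its edges lie. Every vertex placed at an internal node
  \<open>d\<close> is on the boundary of a random union of parts at \<open>d\<close> with probability at least one half, so
  at most \<open>2 * k - 1\<close> vertices are placed at \<open>d\<close>. Adjacent vertices are placed at comparable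
  nodes, and a path from the centre to a leaf has at most \<open>k\<close> internal nodes; vertices of degree
  one contribute one further level.
\<close>

section \<open>Walks\<close>

text \<open>Both bounds handle a rooted forest through its ancestor sets: tree-depth at most
  \<open>h\<close> means that every vertex has fewer than \<open>h\<close> ancestors and adjacent
  vertices are comparable. In the lower bound the obstacle is that the leaves of the decomposition
  tree have to be exactly the edges, so forest vertices with no edge leaf below them are pruned and
  the new root needs degree at least two. The \<open>- 1\<close> pays for the level of the edge
  leaves. In the upper bound, \<open>k\<close> internal nodes with at most \<open>2 * k - 1\<close>
  vertices each give \<open>2 * k^2 - k\<close>, and the \<open>+ 1\<close> is a vertex placed at
  the leaf that ends the path. The obstacle is a leaf that carries two vertices, which would add two
  levels; these vertices meet no edge but their common one, so they can form a tree of height two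
  apart from the others. The 2 in the maximum is needed for a graph whose only edge has two distinct
  ends: its branch-depth is 0 by convention, its tree-depth is 2.\<close>

lemma walk_singleton: "v \<in> V \<Longrightarrow> walk V F [v]"
  by (simp add: walk_def)

lemma walk_append:
  assumes "walk V F p" "walk V F q" "last p = hd q"
  shows "walk V F (p @ tl q)" "hd (p @ tl q) = hd p" "last (p @ tl q) = last q"
proof -
  obtain a q' where q: "q = a # q'"
    using assms(2) by (cases q) (auto simp: walk_def)
  have p: "p \<noteq> []"
    using assms(1) by (simp add: walk_def)
  show "walk V F (p @ tl q)"
    using assms p unfolding q walk_def
    by (auto simp: successively_append_iff successively_Cons)
  show "hd (p @ tl q) = hd p" "last (p @ tl q) = last q"
    using p assms(3) by (auto simp: q)
qed

lemma walk_rev: "walk V F p \<Longrightarrow> walk V F (rev p)"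
  by (simp add: walk_def insert_commute)

lemma walk_prefix:
  assumes "walk V F (p @ x # q)"
  shows "walk V F (p @ [x])" "walk V F (x # q)"
  using assms by (auto simp: walk_def successively_append_iff)

text \<open>Turns the components of a tree minus a node, which live in a smaller graph, into walks
  of the tree that miss the node.\<close>

lemma walk_avoiding:
  "walk (V - {x}) {e \<in> F. x \<notin> e} p \<longleftrightarrow> walk V F p \<and> x \<notin> set p"
proof -
  have "successively (\<lambda>u v. {u, v} \<in> {e \<in> F. x \<notin> e}) p \<longleftrightarrow> successively (\<lambda>u v. {u, v} \<in> F) p"
    if "x \<notin> set p"
    using that by (intro successively_cong) auto
  then show ?thesis
    unfolding walk_def by blast
qed

lemma joinedI: "walk V F p \<Longrightarrow> hd p = u \<Longrightarrow> last p = v \<Longrightarrow> joined V F u v"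
  by (auto simp: joined_def)

lemma joined_refl: "v \<in> V \<Longrightarrow> joined V F v v"
  by (rule joinedI[OF walk_singleton]) auto

lemma joined_edge: "u \<in> V \<Longrightarrow> v \<in> V \<Longrightarrow> {u, v} \<in> F \<Longrightarrow> joined V F u v"
  by (rule joinedI[of _ _ "[u, v]"]) (auto simp: walk_def)

lemma joined_trans: "joined V F u v \<Longrightarrow> joined V F v w \<Longrightarrow> joined V F u w"
  using walk_append[of V F] by (auto simp: joined_def) metis

lemma joined_sym: "joined V F u v \<Longrightarrow> joined V F v u"
  using walk_rev[of V F] by (auto simp: joined_def) (metis hd_rev last_rev)

lemma joined_in: "joined V F u v \<Longrightarrow> u \<in> V \<and> v \<in> V"
  by (auto simp: joined_def walk_def)

lemma joined_avoiding:
  "joined (V - {x}) {e \<in> F. x \<notin> e} u v \<longleftrightarrow> (\<exists>p. walk V F p \<and> x \<notin> set p \<and> hd p = u \<and> last p = v)"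
  unfolding joined_def walk_avoiding by blast

lemma walk_distinct:
  assumes "walk V F p"
  shows "\<exists>q. walk V F q \<and> distinct q \<and> hd q = hd p \<and> last q = last p \<and> set q \<subseteq> set p"
  using assms
proof (induction "length p" arbitrary: p rule: less_induct)
  case less
  show ?case
  proof (cases "distinct p")
    case True
    then show ?thesis using less.prems by blast
  next
    case False
    then obtain xs ys zs y where p: "p = xs @ [y] @ ys @ [y] @ zs"
      using not_distinct_decomp by blast
    let ?q = "xs @ [y] @ zs"
    have "walk V F (xs @ [y])" "walk V F (y # zs)"
      using walk_prefix[of V F xs y "ys @ [y] @ zs"] walk_prefix[of V F "xs @ [y] @ ys" y zs]
        less.prems p by auto
    then have "walk V F ?q"
      using walk_append(1)[of V F "xs @ [y]" "y # zs"] by simp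
    moreover have "length ?q < length p"
      by (simp add: p)
    moreover have "hd ?q = hd p" "last ?q = last p" "set ?q \<subseteq> set p"
      by (auto simp: p hd_append)
    ultimately show ?thesis
      using less.hyps by (metis (no_types, lifting) order_trans)
  qed
qed

lemma distance_walk:
  assumes "joined V F u v"
  shows "\<exists>p. walk V F p \<and> hd p = u \<and> last p = v \<and> length p = Suc (distance V F u v)"
  unfolding distance_def
proof (rule LeastI_ex)
  obtain p where p: "walk V F p" "hd p = u" "last p = v"
    using assms by (auto simp: joined_def)
  then show "\<exists>n p. walk V F p \<and> hd p = u \<and> last p = v \<and> length p = Suc n"
    by (intro exI[of _ "length p - 1"] exI[of _ p]) (auto simp: walk_def)
qed

lemma distance_le:
  assumes "walk V F p"
  shows "distance V F (hd p) (last p) < length p"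
proof -
  have "length p = Suc (length p - 1)"
    using assms by (cases p) (auto simp: walk_def)
  then have "distance V F (hd p) (last p) \<le> length p - 1"
    unfolding distance_def using assms by (intro Least_le) blast
  then show ?thesis
    using \<open>length p = Suc (length p - 1)\<close> by linarith
qed

text \<open>A walk between two distinct neighbours of \<open>d\<close> that misses \<open>d\<close>
  shortens to a path, which \<open>d\<close> closes to a cycle. Acyclicity of a given forest is
  exploited only through this lemma.\<close>

lemma forest_neighbour_unique:
  assumes "forest V F" "{a, d} \<in> F" "{b, d} \<in> F"
    and "walk V F p" "d \<notin> set p" "hd p = a" "last p = b"
  shows "a = b"
proof (rule ccontr)
  assume "a \<noteq> b"
  obtain q where q: "walk V F q" "distinct q" "hd q = a" "last q = b" "set q \<subseteq> set p"
    using walk_distinct[OF assms(4)] assms(6,7) by blast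
  have len: "2 \<le> length q"
    using q \<open>a \<noteq> b\<close> by (cases q rule: remdups_adj.cases) (auto simp: walk_def)
  have "d \<in> V"
    using assms(1,2) by (auto simp: forest_def simple_graph_def)
  moreover have "q \<noteq> []" using len by auto
  moreover have "d \<notin> set q" using q(5) assms(5) by auto
  ultimately have "is_cycle V F (d # q)"
    using q len assms(2,3) unfolding is_cycle_def walk_def
    by (auto simp: successively_Cons insert_commute)
  then show False
    using assms(1) by (auto simp: forest_def)
qed


section \<open>Forests given by a parent function\<close>

text \<open>Both the forest of the upper bound and the decomposition tree of the lower bound are
  given by parent pointers. The depth function rules out cycles of pointers and turns out to be the
  distance from the root.\<close>

locale parent_forest =
  fixes V R :: "'a set" and par :: "'a \<Rightarrow> 'a" and dep :: "'a \<Rightarrow> nat"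
  assumes finite_V: "finite V"
    and roots: "R \<subseteq> V"
    and dep_root: "x \<in> R \<Longrightarrow> dep x = 0"
    and par_in: "x \<in> V - R \<Longrightarrow> par x \<in> V"
    and dep_par: "x \<in> V - R \<Longrightarrow> dep x = Suc (dep (par x))"
begin

definition F where "F = (\<lambda>x. {x, par x}) ` (V - R)"

definition root_of where "root_of x = (par ^^ dep x) x"

lemma edge_cases:
  assumes "{a, b} \<in> F"
  obtains "a \<in> V - R" "b = par a" | "b \<in> V - R" "a = par b"
  using assms by (auto simp: F_def doubleton_eq_iff)

lemma edge_par: "x \<in> V - R \<Longrightarrow> {x, par x} \<in> F" "x \<in> V - R \<Longrightarrow> {par x, x} \<in> F"
  by (auto simp: F_def insert_commute)

lemma par_neq: "x \<in> V - R \<Longrightarrow> par x \<noteq> x"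
  using dep_par by fastforce

lemma simple: "simple_graph V F"
  using par_neq[symmetric] par_in finite_V by (auto simp: simple_graph_def F_def)

lemma top_neighbour:
  assumes "{a, b} \<in> F" "dep b \<le> dep a"
  shows "b = par a"
  using assms(1) by (rule edge_cases) (use dep_par[of b] assms(2) in auto)

text \<open>At a deepest vertex of a cycle both neighbours on the cycle would be its parent,
  although they are distinct.\<close>

lemma forest: "forest V F"
  unfolding forest_def
proof (intro conjI simple notI)
  assume "\<exists>p. is_cycle V F p"
  then obtain p where p: "walk V F p" "distinct p" "3 \<le> length p" "{last p, hd p} \<in> F"
    by (auto simp: is_cycle_def)
  let ?n = "length p"
  have adj: "{p ! i, p ! ((i + 1) mod ?n)} \<in> F" if "i < ?n" for i
  proof (cases "Suc i < ?n")
    case True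
    then show ?thesis
      using p(1) successively_nth[of "\<lambda>u v. {u, v} \<in> F" p i] by (auto simp: walk_def)
  next
    case False
    then have "i = ?n - 1" "p \<noteq> []" using that by auto
    then show ?thesis using p(4) by (simp add: last_conv_nth hd_conv_nth)
  qed
  obtain i where i: "i < ?n" "\<And>j. j < ?n \<Longrightarrow> dep (p ! j) \<le> dep (p ! i)"
  proof -
    have "Max (dep ` set p) \<in> dep ` set p"
      using p(3) by (intro Max_in) auto
    then obtain i where "i < ?n" "dep (p ! i) = Max (dep ` set p)"
      by (metis (no_types, lifting) imageE in_set_conv_nth)
    then show ?thesis using that by (metis List.finite_set Max_ge finite_imageI imageI nth_mem)
  qed
  define j where "j = (i + 1) mod ?n"
  define l where "l = (if i = 0 then ?n - 1 else i - 1)"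
  have l: "l < ?n" "(l + 1) mod ?n = i"
    using i(1) p(3) by (auto simp: l_def)
  have j: "j < ?n" unfolding j_def using p(3) by (intro mod_less_divisor) linarith
  \<comment> \<open>Length at least three matters here: in a cyclic list of two vertices the
    predecessor and the successor coincide.\<close>
  have "l \<noteq> j"
    using i(1) p(3) by (auto simp: l_def j_def mod_Suc split: if_splits)
  have "p ! j = par (p ! i)"
    by (rule top_neighbour) (use adj[OF i(1)] i(2)[OF j] in \<open>auto simp: j_def\<close>)
  moreover have "p ! l = par (p ! i)"
    by (rule top_neighbour) (use adj[OF l(1)] i(2)[OF l(1)] l in \<open>auto simp: insert_commute\<close>)
  ultimately show False
    using p(2) l(1) j \<open>l \<noteq> j\<close> by (metis nth_eq_iff_index_eq)
qed

lemma root_of_par: "x \<in> V - R \<Longrightarrow> root_of x = root_of (par x)"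
  by (simp add: root_of_def dep_par funpow_swap1)

lemma root_of_root: "x \<in> R \<Longrightarrow> root_of x = x"
  by (simp add: root_of_def dep_root)

lemma root_walk:
  assumes "x \<in> V"
  shows "root_of x \<in> R \<and> (\<exists>p. walk V F p \<and> hd p = root_of x \<and> last p = x \<and> length p = Suc (dep x))"
  using assms
proof (induction "dep x" arbitrary: x)
  case 0
  then have "x \<in> R" using dep_par by fastforce
  then show ?case
    using 0 by (auto simp: root_of_root intro!: exI[of _ "[x]"] walk_singleton)
next
  case (Suc n)
  then have x: "x \<in> V - R" using dep_root by fastforce
  then obtain p where p: "root_of (par x) \<in> R" "walk V F p" "hd p = root_of (par x)"
      "last p = par x" "length p = Suc (dep (par x))"
    using Suc.hyps par_in dep_par by (metis Suc_inject)
  have "walk V F (p @ [x])"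
    using p x edge_par by (auto simp: walk_def successively_append_iff)
  moreover have "p \<noteq> []" using p(2) by (simp add: walk_def)
  ultimately show ?case
    using p root_of_par[OF x] dep_par[OF x] by (auto intro!: exI[of _ "p @ [x]"])
qed

text \<open>Along an edge the root stays the same and the depth changes by at most one. Hence a
  component has only one root, and no walk from it is shorter than the depth.\<close>

lemma walk_root_of:
  assumes "walk V F p" shows "root_of (hd p) = root_of (last p) \<and> dep (last p) < dep (hd p) + length p"
  using assms
proof (induction p rule: induct_list012)
  case (3 a b p)
  then have "{a, b} \<in> F" and IH: "root_of b = root_of (last (b # p)) \<and> dep (last (b # p)) < dep b + length (b # p)"
    by (auto simp: walk_def)
  from this(1) show ?case
    by (rule edge_cases) (use IH root_of_par dep_par in \<open>fastforce+\<close>)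
qed (auto simp: walk_def)

lemma joined_root_of:
  assumes "r \<in> R" "joined V F r x"
  shows "r = root_of x"
proof -
  obtain p where "walk V F p" "hd p = r" "last p = x"
    using assms(2) by (auto simp: joined_def)
  then show ?thesis
    using walk_root_of[of p] root_of_root[OF assms(1)] by simp
qed

lemma joined_root: "x \<in> V \<Longrightarrow> joined V F (root_of x) x"
  using root_walk[of x] by (auto simp: joined_def)

lemma rooted_forest: "rooted_forest V F R"
  unfolding rooted_forest_def
proof (intro conjI ballI forest roots)
  fix C assume "C \<in> components V F"
  then obtain u where u: "u \<in> V" "C = {v. joined V F u v}"
    by (auto simp: components_def)
  show "\<exists>!r. r \<in> R \<and> r \<in> C"
  proof (rule ex1I[of _ "root_of u"])
    show "root_of u \<in> R \<and> root_of u \<in> C"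
      using u root_walk joined_root joined_sym by fastforce
    show "r = root_of u" if "r \<in> R \<and> r \<in> C" for r
      using that u joined_root_of joined_sym by fastforce
  qed
qed

lemma distance_root: "x \<in> V \<Longrightarrow> distance V F (root_of x) x = dep x"
  unfolding distance_def
proof (rule Least_equality)
  fix n assume "\<exists>p. walk V F p \<and> hd p = root_of x \<and> last p = x \<and> length p = Suc n" "x \<in> V"
  then show "dep x \<le> n"
    using walk_root_of root_walk dep_root by fastforce
qed (use root_walk in blast)

lemma arcs_iff: "(u, v) \<in> arcs V F R \<longleftrightarrow> v \<in> V - R \<and> u = par v"
proof
  assume "(u, v) \<in> arcs V F R"
  then obtain r where uv: "{u, v} \<in> F" and r: "r \<in> R" "joined V F r u"
    and d: "distance V F r v = Suc (distance V F r u)"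
    by (auto simp: arcs_def)
  have V: "u \<in> V" "v \<in> V"
    using uv simple by (auto simp: simple_graph_def)
  have "r = root_of u" using r joined_root_of by blast
  moreover have "r = root_of v"
    using r joined_root_of joined_trans joined_edge uv V by metis
  ultimately have "dep v = Suc (dep u)"
    using d distance_root V by metis
  with uv show "v \<in> V - R \<and> u = par v"
    by (elim edge_cases) (auto simp: dep_par)
next
  assume v: "v \<in> V - R \<and> u = par v"
  have "joined V F (root_of v) (par v)"
    using v joined_root[of "par v"] par_in root_of_par by auto
  moreover have "distance V F (root_of v) v = Suc (distance V F (root_of v) (par v))"
    using v distance_root[of v] distance_root[of "par v"] par_in root_of_par dep_par by auto
  ultimately show "(u, v) \<in> arcs V F R"
    using v root_walk edge_par by (auto simp: arcs_def)
qed

section \<open>Height, leaves and radius of a forest with parent pointers\<close>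

lemma directed_dep:
  assumes "p \<noteq> []" "successively (\<lambda>u v. (u, v) \<in> arcs V F R) p"
  shows "dep (last p) + 1 = dep (hd p) + length p"
  using assms by (induction p rule: induct_list012) (auto simp: arcs_iff dep_par)

lemma height_le:
  assumes "\<And>x. x \<in> V \<Longrightarrow> dep x < h"
  shows "height V F R \<le> h"
proof -
  have len: "length p \<le> h" if "directed_path V F R p" for p
  proof -
    have "last p \<in> V" using that by (auto simp: directed_path_def)
    with assms[of "last p"] directed_dep[of p] that show ?thesis
      by (auto simp: directed_path_def)
  qed
  have "length ` {p. directed_path V F R p} \<subseteq> {..h}" using len by auto
  then have "finite (length ` {p. directed_path V F R p})"
    by (rule finite_subset) auto
  then show ?thesis
    unfolding height_def using len by auto
qed

lemma incident: "{e \<in> F. x \<in> e} = (\<lambda>y. {y, par y}) ` {y \<in> V - R. y = x \<or> par y = x}"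
  by (auto simp: F_def)

lemma leafI:
  assumes "x \<in> V - R" "\<And>y. y \<in> V - R \<Longrightarrow> par y \<noteq> x"
  shows "x \<in> leaves V F"
proof -
  have "{y \<in> V - R. y = x \<or> par y = x} = {x}"
    using assms by auto
  then show ?thesis
    using assms(1) by (simp add: leaves_def incident)
qed

text \<open>Edges are indexed by their lower ends. Two lower ends can give the same edge only if
  each is the parent of the other, which the depth forbids.\<close>

lemma two_edges_not_leaf:
  assumes "y \<in> V - R" "z \<in> V - R" "y \<noteq> z" "y = x \<or> par y = x" "z = x \<or> par z = x"
  shows "x \<notin> leaves V F"
proof
  assume "x \<in> leaves V F"
  then have "card {e \<in> F. x \<in> e} = 1" by (simp add: leaves_def)
  then obtain e where "{e \<in> F. x \<in> e} = {e}" by (auto simp: card_1_singleton_iff)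
  moreover have "{y, par y} \<in> {e \<in> F. x \<in> e}" "{z, par z} \<in> {e \<in> F. x \<in> e}"
    using assms edge_par by auto
  ultimately have "{y, par y} = {z, par z}" by auto
  then have "y = par z" "z = par y" using assms(3) by (auto simp: doubleton_eq_iff)
  then show False using dep_par[OF assms(1)] dep_par[OF assms(2)] by simp
qed

lemma treeI:
  assumes "R = {r}"
  shows "tree V F"
proof -
  have "joined V F r x" if "x \<in> V" for x
    using joined_root[OF that] root_walk[OF that] assms by auto
  then show ?thesis
    unfolding tree_def using forest roots assms by (auto intro: joined_trans joined_sym)
qed

lemma radius_le:
  assumes "R = {r}" "\<And>x. x \<in> V \<Longrightarrow> dep x \<le> n"
  shows "radius V F \<le> n"
  unfolding radius_def
proof (rule Least_le, intro bexI[of _ r] ballI)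
  show "r \<in> V" using roots assms by auto
  show "distance V F r w \<le> n" if "w \<in> V" for w
    using distance_root[OF that] root_walk[OF that] assms that by auto
qed

end


section \<open>Tree orders\<close>

text \<open>A rooted forest encoded by its strict ancestor sets. Comparability of any two ancestors
  of a vertex is what makes the order a forest; the edges are recovered from it through
  \<open>parent\<close>.\<close>

locale tree_order =
  fixes V :: "'a set" and anc :: "'a \<Rightarrow> 'a set"
  assumes finite_vertices: "finite V"
    and anc_subset: "x \<in> V \<Longrightarrow> anc x \<subseteq> V"
    and anc_irrefl: "x \<in> V \<Longrightarrow> x \<notin> anc x"
    and anc_trans: "x \<in> V \<Longrightarrow> y \<in> anc x \<Longrightarrow> anc y \<subseteq> anc x"
    and anc_chain: "x \<in> V \<Longrightarrow> y \<in> anc x \<Longrightarrow> z \<in> anc x \<Longrightarrow> y = z \<or> y \<in> anc z \<or> z \<in> anc y"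
begin

definition parent where "parent x = (SOME y. y \<in> anc x \<and> anc x = insert y (anc y))"

definition roots where "roots = {x \<in> V. anc x = {}}"

lemma finite_anc: "x \<in> V \<Longrightarrow> finite (anc x)"
  using anc_subset finite_vertices finite_subset by blast

text \<open>The nearest ancestor is one that itself has the most ancestors: an ancestor not above it
  would lie below it and have more.\<close>

lemma parent:
  assumes "x \<in> V" "anc x \<noteq> {}"
  shows "parent x \<in> anc x" "anc x = insert (parent x) (anc (parent x))"
proof -
  define m where "m = Max ((\<lambda>y. card (anc y)) ` anc x)"
  have "m \<in> (\<lambda>y. card (anc y)) ` anc x"
    unfolding m_def using assms finite_anc by (intro Max_in) auto
  then obtain y where y: "y \<in> anc x" "card (anc y) = m" by auto
  have "z = y \<or> z \<in> anc y" if z: "z \<in> anc x" for z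
  proof (rule ccontr)
    assume neg: "\<not> (z = y \<or> z \<in> anc y)"
    then have "y \<in> anc z" using anc_chain assms(1) y(1) z by blast
    have zV: "z \<in> V" using anc_subset assms(1) z by blast
    then have "anc y \<subset> anc z" using anc_trans \<open>y \<in> anc z\<close> anc_irrefl anc_subset by blast
    then have "m < card (anc z)" using y(2) psubset_card_mono finite_anc[OF zV] by blast
    moreover have "card (anc z) \<le> m"
      unfolding m_def using z finite_anc[OF assms(1)] by auto
    ultimately show False by simp
  qed
  then have "y \<in> anc x \<and> anc x = insert y (anc y)" using y(1) anc_trans[OF assms(1) y(1)] by blast
  then have "parent x \<in> anc x \<and> anc x = insert (parent x) (anc (parent x))"
    unfolding parent_def by (rule someI)
  then show "parent x \<in> anc x" "anc x = insert (parent x) (anc (parent x))" by blast+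
qed

sublocale parent_forest V roots parent "\<lambda>x. card (anc x)"
proof
  show "card (anc x) = Suc (card (anc (parent x)))" if "x \<in> V - roots" for x
  proof -
    have x: "x \<in> V" "anc x \<noteq> {}" using that by (auto simp: roots_def)
    then have "parent x \<in> V" using parent anc_subset by blast
    then show ?thesis using parent[OF x] finite_anc anc_irrefl by (metis card_insert_disjoint)
  qed
  show "parent x \<in> V" if "x \<in> V - roots" for x
    using that parent(1)[of x] anc_subset[of x] by (auto simp: roots_def)
qed (use finite_vertices in \<open>auto simp: roots_def\<close>)

text \<open>The path grows downwards by appending \<open>x\<close> to a path ending at
  \<open>parent x\<close>. Confining its vertices to \<open>x\<close> and its ancestors keeps it
  distinct in the induction.\<close>

lemma directed_from_ancestor:
  assumes "x \<in> V" "y = x \<or> y \<in> anc x"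
  shows "\<exists>p. directed_path V F roots p \<and> hd p = y \<and> last p = x \<and> set p \<subseteq> insert x (anc x)"
  using assms
proof (induction "card (anc x)" arbitrary: x)
  case 0
  then show ?case
    using finite_anc by (auto simp: directed_path_def intro!: exI[of _ "[x]"])
next
  case (Suc n)
  show ?case
  proof (cases "y = x")
    case True
    then show ?thesis using Suc by (auto simp: directed_path_def intro!: exI[of _ "[x]"])
  next
    case False
    then have x: "x \<in> V" "anc x \<noteq> {}" using Suc by auto
    note P = parent[OF x]
    have pV: "parent x \<in> V" using P anc_subset x by blast
    have "x \<in> V - roots" using x by (auto simp: roots_def)
    then have "n = card (anc (parent x))" using Suc dep_par by auto
    moreover have "y = parent x \<or> y \<in> anc (parent x)" using P Suc False by auto
    ultimately obtain p where p: "directed_path V F roots p" "hd p = y" "last p = parent x"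
        "set p \<subseteq> insert (parent x) (anc (parent x))"
      using Suc.hyps(1) pV by blast
    have "x \<notin> set p" using p(4) P(2) anc_irrefl x by blast
    then have "directed_path V F roots (p @ [x])"
      using p x \<open>x \<in> V - roots\<close> by (auto simp: directed_path_def successively_append_iff arcs_iff)
    moreover have "p \<noteq> []" using p(1) by (simp add: directed_path_def)
    ultimately show ?thesis
      using p P(2) by (intro exI[of _ "p @ [x]"]) auto
  qed
qed

lemma closure_ancestor:
  assumes "x \<in> V" "y \<in> anc x"
  shows "{y, x} \<in> closure_edges V F roots"
proof -
  obtain p where "directed_path V F roots p" "hd p = y" "last p = x"
    using directed_from_ancestor assms by metis
  moreover have "y \<noteq> x"
    using assms anc_irrefl by auto
  ultimately show ?thesis
    unfolding closure_edges_def by auto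
qed

text \<open>The interface for all upper bounds on tree-depth: few ancestors, and every edge joins a
  vertex to one of its ancestors.\<close>

lemma simple_tree_depth_le:
  assumes "\<And>x. x \<in> V \<Longrightarrow> card (anc x) < h"
    and "\<And>e. e \<in> D \<Longrightarrow> \<exists>x\<in>V. \<exists>y\<in>anc x. e = {y, x}"
  shows "simple_tree_depth V D \<le> h"
proof -
  have "D \<subseteq> closure_edges V F roots" using assms(2) closure_ancestor by blast
  then have "simple_tree_depth V D \<le> height V F roots"
    unfolding simple_tree_depth_def using rooted_forest by (intro Least_le) blast
  then show ?thesis using height_le[OF assms(1)] by force
qed

end

section \<open>The ancestor order of a rooted forest\<close>

lemma arc_in: "rooted_forest V F R \<Longrightarrow> (u, v) \<in> arcs V F R \<Longrightarrow> u \<in> V \<and> v \<in> V \<and> {u, v} \<in> F"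
  by (auto simp: rooted_forest_def forest_def simple_graph_def arcs_def)

lemma component_root_unique:
  assumes "rooted_forest V F R" "r \<in> R" "r' \<in> R" "joined V F r v" "joined V F r' v"
  shows "r = r'"
proof -
  have C: "{w. joined V F v w} \<in> components V F"
    using joined_in[OF assms(4)] by (auto simp: components_def)
  have "\<forall>C\<in>components V F. \<exists>!r. r \<in> R \<and> r \<in> C"
    using assms(1) by (simp add: rooted_forest_def)
  from bspec[OF this C] have "\<exists>!r. r \<in> R \<and> joined V F v r"
    by simp
  then show ?thesis
    using assms(2,3) joined_sym[OF assms(4)] joined_sym[OF assms(5)] by (elim ex1E) metis
qed

lemma arcD:
  assumes "rooted_forest V F R" "(u, v) \<in> arcs V F R"
  obtains r where "r \<in> R" "joined V F r u" "joined V F r v" "{u, v} \<in> F"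
    "distance V F r v = Suc (distance V F r u)"
proof -
  have "joined V F u v" using arc_in[OF assms] joined_edge by metis
  moreover obtain r where "r \<in> R" "joined V F r u" "{u, v} \<in> F"
      "distance V F r v = Suc (distance V F r u)"
    using assms(2) by (auto simp: arcs_def)
  ultimately show ?thesis using that joined_trans by metis
qed

text \<open>Each arc moves one step away from the root of its component, and that root is the same
  for consecutive arcs. This makes the ancestor relation irreflexive.\<close>

lemma trancl_arcs_distance:
  assumes "rooted_forest V F R" "(u, v) \<in> (arcs V F R)\<^sup>+"
  shows "\<exists>r\<in>R. joined V F r u \<and> joined V F r v \<and> distance V F r u < distance V F r v"
  using assms(2)
proof (induction rule: trancl_induct)
  case (base v)
  then show ?case by (elim arcD[OF assms(1)]) auto
next
  case (step v w)
  from step.hyps(2) obtain r where r: "r \<in> R" "joined V F r v" "joined V F r w"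
      "distance V F r w = Suc (distance V F r v)"
    by (rule arcD[OF assms(1)])
  from step.IH obtain s where s: "s \<in> R" "joined V F s u" "joined V F s v"
      "distance V F s u < distance V F s v" by blast
  have "r = s" by (rule component_root_unique[OF assms(1) r(1) s(1) r(2) s(3)])
  then show ?case using r s by (intro bexI[of _ r]) auto
qed

lemma trancl_arcs_irrefl: "rooted_forest V F R \<Longrightarrow> (u, u) \<notin> (arcs V F R)\<^sup>+"
  using trancl_arcs_distance[of V F R u u] by auto

text \<open>A shortest walk from \<open>r\<close> to \<open>u\<close> has too few vertices to visit
  \<open>v\<close>, which is farther from \<open>r\<close>.\<close>

lemma arc_tail_walk:
  assumes "joined V F r u" "distance V F r v = Suc (distance V F r u)"
  shows "\<exists>p. walk V F p \<and> hd p = r \<and> last p = u \<and> v \<notin> set p"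
proof -
  obtain p where p: "walk V F p" "hd p = r" "last p = u" "length p = Suc (distance V F r u)"
    using distance_walk[OF assms(1)] by blast
  have "v \<notin> set p"
  proof
    assume "v \<in> set p"
    then obtain a b where ab: "p = a @ v # b" using split_list by metis
    have "walk V F (a @ [v])" using walk_prefix(1) p(1) ab by metis
    moreover have "hd (a @ [v]) = r" using p(2) ab by (cases a) auto
    ultimately have "distance V F r v < length (a @ [v])"
      using distance_le[of V F "a @ [v]"] by simp
    then show False using assms(2) p(4) ab by simp
  qed
  then show ?thesis using p by blast
qed

text \<open>From the common root, both tails are reached by walks that miss \<open>v\<close>.
  Together these join the two neighbours of \<open>v\<close> without \<open>v\<close>, so acyclicity
  makes them equal.\<close>

lemma arc_unique:
  assumes "rooted_forest V F R" "(a, v) \<in> arcs V F R" "(b, v) \<in> arcs V F R"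
  shows "a = b"
proof -
  from assms(2) obtain r where r: "r \<in> R" "joined V F r a" "joined V F r v" "{a, v} \<in> F"
      "distance V F r v = Suc (distance V F r a)"
    by (rule arcD[OF assms(1)])
  from assms(3) obtain s where s: "s \<in> R" "joined V F s b" "joined V F s v" "{b, v} \<in> F"
      "distance V F s v = Suc (distance V F s b)"
    by (rule arcD[OF assms(1)])
  have "r = s" by (rule component_root_unique[OF assms(1) r(1) s(1) r(3) s(3)])
  obtain p where p: "walk V F p" "hd p = r" "last p = a" "v \<notin> set p"
    using arc_tail_walk[OF r(2,5)] by blast
  obtain q where q: "walk V F q" "hd q = r" "last q = b" "v \<notin> set q"
    using arc_tail_walk[OF s(2,5)] \<open>r = s\<close> by blast
  have "p \<noteq> []" "q \<noteq> []" using p(1) q(1) by (auto simp: walk_def)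
  have 1: "last (rev p) = hd q" using p q \<open>p \<noteq> []\<close> by (simp add: last_rev)
  have "v \<notin> set (rev p @ tl q)"
    using p(4) q(4) list.set_sel(2)[OF \<open>q \<noteq> []\<close>] by auto
  then show ?thesis
    using forest_neighbour_unique[of V F a v b "rev p @ tl q"] assms(1) r(4) s(4)
      walk_append[OF walk_rev[OF p(1)] q(1) 1] p(3) q(3) hd_rev[of p]
    by (auto simp: rooted_forest_def)
qed

lemma directed_trancl:
  assumes "directed_path V F R p" "hd p \<noteq> last p"
  shows "(hd p, last p) \<in> (arcs V F R)\<^sup>+"
proof -
  have "p \<noteq> [] \<Longrightarrow> successively (\<lambda>u v. (u, v) \<in> arcs V F R) p \<Longrightarrow> (hd p, last p) \<in> (arcs V F R)\<^sup>*"
    by (induction p rule: induct_list012) (auto intro: converse_rtrancl_into_rtrancl)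
  then have "(hd p, last p) \<in> (arcs V F R)\<^sup>*"
    using assms(1) by (auto simp: directed_path_def)
  then show ?thesis using assms(2) by (simp add: rtrancl_eq_or_trancl)
qed

lemma rooted_forest_tree_order:
  assumes rf: "rooted_forest V F R"
  shows "tree_order V (\<lambda>x. {y. (y, x) \<in> (arcs V F R)\<^sup>+})"
proof
  let ?A = "arcs V F R"
  show "finite V" using rf by (auto simp: rooted_forest_def forest_def simple_graph_def)
  show "{y. (y, x) \<in> ?A\<^sup>+} \<subseteq> V" for x
    using trancl_arcs_distance[OF rf] joined_in by fastforce
  show "x \<notin> {y. (y, x) \<in> ?A\<^sup>+}" for x
    using trancl_arcs_irrefl[OF rf] by auto
  show "{z. (z, y) \<in> ?A\<^sup>+} \<subseteq> {y. (y, x) \<in> ?A\<^sup>+}" if "y \<in> {y. (y, x) \<in> ?A\<^sup>+}" for x y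
    using that by (auto intro: trancl_trans)
  show "y = z \<or> y \<in> {y. (y, z) \<in> ?A\<^sup>+} \<or> z \<in> {z. (z, y) \<in> ?A\<^sup>+}"
    if yx: "y \<in> {y. (y, x) \<in> ?A\<^sup>+}" and zx: "z \<in> {y. (y, x) \<in> ?A\<^sup>+}" for x y z
  proof -
    \<comment> \<open>With at most one arc into each vertex, climbing is deterministic, so of two
      ancestors of \<open>x\<close> one is met on the way to the other.\<close>
    have sv: "single_valued (?A\<inverse>)"
      using arc_unique[OF rf] by (auto simp: single_valued_def)
    have "(x, y) \<in> (?A\<inverse>)\<^sup>*" "(x, z) \<in> (?A\<inverse>)\<^sup>*"
      using yx zx by (simp_all add: rtrancl_converse trancl_into_rtrancl)
    then have "(y, z) \<in> (?A\<inverse>)\<^sup>* \<or> (z, y) \<in> (?A\<inverse>)\<^sup>*"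
      by (rule single_valued_confluent[OF sv])
    then show ?thesis
      by (auto simp: rtrancl_converse rtrancl_eq_or_trancl)
  qed
qed

lemma card_ancestors_less_height:
  assumes rf: "rooted_forest V F R" and "x \<in> V"
  shows "card {y. (y, x) \<in> (arcs V F R)\<^sup>+} < height V F R"
proof -
  let ?anc = "\<lambda>x. {y. (y, x) \<in> (arcs V F R)\<^sup>+}"
  interpret tree_order V ?anc by (rule rooted_forest_tree_order[OF rf])
  have "\<exists>p. directed_path V F R p \<and> last p = x \<and> set p = insert x (?anc x)" if "x \<in> V" for x
    using that
  proof (induction "card (?anc x)" arbitrary: x)
    case 0
    then have "?anc x = {}" using finite_anc[OF 0(2)] by simp
    then show ?case using 0 by (intro exI[of _ "[x]"]) (auto simp: directed_path_def)
  next
    case (Suc n)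
    then have ne: "?anc x \<noteq> {}" by force
    let ?y = "parent x"
    have x: "x \<in> V - roots" using Suc.prems ne by (simp add: roots_def)
    have n: "n = card (?anc ?y)" using Suc.hyps(2) dep_par[OF x] by simp
    have "?y \<in> V" using par_in x by blast
    then obtain p where p: "directed_path V F R p" "last p = ?y" "set p = insert ?y (?anc ?y)"
      using Suc.hyps(1)[OF n] by blast
    have P: "?y \<in> ?anc x" "?anc x = insert ?y (?anc ?y)"
      using parent[OF Suc.prems ne] by blast+
    have "(?y, x) \<in> (arcs V F R)\<^sup>+" using P(1) by simp
    then obtain z where z: "(?y, z) \<in> (arcs V F R)\<^sup>*" "(z, x) \<in> arcs V F R"
      by (metis tranclD2)
    \<comment> \<open>The last arc on the way from \<open>parent x\<close> to \<open>x\<close>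
      starts at \<open>parent x\<close>: another tail would be a proper ancestor of
      \<open>parent x\<close> and also reachable from it.\<close>
    have "z = ?y"
    proof (rule ccontr)
      assume "z \<noteq> ?y"
      then have "z \<in> ?anc ?y" using P(2) z(2) by auto
      then have "(?y, ?y) \<in> (arcs V F R)\<^sup>+"
        using z(1) by (auto intro: rtrancl_trancl_trancl)
      then show False using trancl_arcs_irrefl[OF rf] by blast
    qed
    have "x \<notin> set p" using P(2) p(3) anc_irrefl[OF Suc.prems] by simp
    then have "directed_path V F R (p @ [x])"
      using p z(2) \<open>z = ?y\<close> Suc.prems by (auto simp: directed_path_def successively_append_iff)
    then show ?case using p P(2) by (intro exI[of _ "p @ [x]"]) auto
  qed
  then obtain p where p: "directed_path V F R p" "set p = insert x (?anc x)"
    using assms(2) by blast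
  have "card (insert x (?anc x)) = length p"
    using p by (metis directed_path_def distinct_card)
  then have len: "Suc (card (?anc x)) = length p"
    using finite_anc[OF assms(2)] anc_irrefl[OF assms(2)] by (metis card_insert_disjoint)
  \<comment> \<open>The height is a \<open>Max\<close>, so the set of path lengths has to be finite;
    distinctness bounds them.\<close>
  have "length q \<le> card V" if "directed_path V F R q" for q
  proof -
    have "distinct q" "set q \<subseteq> V" using that by (auto simp: directed_path_def)
    then show ?thesis using card_mono[OF finite_V] by (metis distinct_card)
  qed
  then have "length ` {p. directed_path V F R p} \<subseteq> {..card V}" by auto
  then have "finite (length ` {p. directed_path V F R p})" by (rule finite_subset) simp
  then have "length p \<le> height V F R"
    unfolding height_def using p(1) by (intro Max_ge) auto
  then show ?thesis using len by simp
qed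

text \<open>An optimal forest as a tree order. The \<open>LEAST\<close> is attained because some
  forest works: numbering \<open>V\<close> orders it linearly, and the closure of the resulting path
  is complete.\<close>

lemma simple_tree_depth_order:
  assumes "finite V" and edges: "\<And>e. e \<in> D \<Longrightarrow> e \<subseteq> V \<and> card e = 2"
  obtains W anc where "tree_order W anc" "V \<subseteq> W"
    "\<forall>x\<in>W. card (anc x) < simple_tree_depth V D"
    "\<forall>e\<in>D. \<exists>x\<in>W. \<exists>y\<in>anc x. e = {y, x}"
proof -
  obtain idx :: "'a \<Rightarrow> nat" where idx: "inj_on idx V"
    using finite_imp_inj_to_nat_seg[OF assms(1)] by metis
  interpret L: tree_order V "\<lambda>x. {y \<in> V. idx y < idx x}"
  proof
    show "y = z \<or> y \<in> {y \<in> V. idx y < idx z} \<or> z \<in> {z \<in> V. idx z < idx y}"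
      if "y \<in> {y \<in> V. idx y < idx x}" "z \<in> {y \<in> V. idx y < idx x}" for x y z
      using that idx by (auto simp: inj_on_def) (meson linorder_neqE_nat)
  qed (use assms(1) in auto)
  have "e \<in> closure_edges V L.F L.roots" if "e \<in> D" for e
  proof -
    obtain a b where ab: "e = {a, b}" "a \<noteq> b" "a \<in> V" "b \<in> V"
      using edges[OF \<open>e \<in> D\<close>] by (auto simp: card_2_iff)
    then have "idx a < idx b \<or> idx b < idx a"
      using idx by (meson inj_on_def linorder_neqE_nat)
    then show ?thesis
      using ab L.closure_ancestor[of b a] L.closure_ancestor[of a b] by (auto simp: insert_commute)
  qed
  then have "\<exists>h W F R. rooted_forest W F R \<and> V \<subseteq> W \<and> D \<subseteq> closure_edges W F R \<and> height W F R = h"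
    using L.rooted_forest by blast
  from LeastI_ex[OF this] obtain W F R where W: "rooted_forest W F R" "V \<subseteq> W"
      "D \<subseteq> closure_edges W F R" "height W F R = simple_tree_depth V D"
    unfolding simple_tree_depth_def by blast
  show ?thesis
  proof (rule that[OF rooted_forest_tree_order[OF W(1)] W(2)]; intro ballI)
    show "card {y. (y, x) \<in> (arcs W F R)\<^sup>+} < simple_tree_depth V D" if "x \<in> W" for x
      using card_ancestors_less_height[OF W(1) that] W(4) by simp
    show "\<exists>x\<in>W. \<exists>y\<in>{y. (y, x) \<in> (arcs W F R)\<^sup>+}. e = {y, x}" if "e \<in> D" for e
    proof -
      obtain p where p: "e = {hd p, last p}" "hd p \<noteq> last p" "directed_path W F R p"
        using W(3) \<open>e \<in> D\<close> unfolding closure_edges_def by blast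
      then have "last p \<in> W" by (auto simp: directed_path_def)
      then show ?thesis using p directed_trancl[OF p(3,2)] by blast
    qed
  qed
qed

section \<open>A decomposition from a rooted forest\<close>

datatype ('v, 'e) node = Root | Vert 'v | Leaf 'e

text \<open>All ends of \<open>e\<close> lie on the chain from \<open>low e\<close> upwards. The
  renaming \<open>emb\<close> exists because branch-depth quantifies over trees on natural numbers.
  The second edge \<open>e1\<close> ensures that the root carries more than the leaf of
  \<open>e0\<close>.\<close>

locale forest_decomposition = tree_order W anc
  for W :: "'v set" and anc :: "'v \<Rightarrow> 'v set" +
  fixes G :: "('v, 'e) mgraph" and t :: nat and low :: "'e \<Rightarrow> 'v" and e0 e1 :: 'e
    and emb :: "('v, 'e) node \<Rightarrow> 'n"
  assumes graph: "finite_mgraph G"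
    and card_anc: "x \<in> W \<Longrightarrow> card (anc x) < t"
    and low: "e \<in> edges G \<Longrightarrow> low e \<in> W"
    and ends_low: "e \<in> edges G \<Longrightarrow> ends G e \<subseteq> insert (low e) (anc (low e))"
    and e0: "e0 \<in> edges G" and e1: "e1 \<in> edges G" "e1 \<noteq> e0"
    and inj_W: "inj_on emb (insert Root (Vert ` W \<union> Leaf ` edges G))"
begin

definition up where "up x = insert x (anc x)"

text \<open>The edge \<open>e0\<close> is hung at the root, so that the root does not become a leaf.\<close>

definition U where "U = {x \<in> W. \<exists>e\<in>edges G - {e0}. x \<in> up (low e)}"

definition nodes :: "('v, 'e) node set" where "nodes = insert Root (Vert ` U \<union> Leaf ` edges G)"

lemma inj_emb: "inj_on emb nodes"
  using inj_W by (rule inj_on_subset) (auto simp: nodes_def U_def)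

lemma emb_eq [simp]: "a \<in> nodes \<Longrightarrow> b \<in> nodes \<Longrightarrow> emb a = emb b \<longleftrightarrow> a = b"
  using inj_emb by (auto simp: inj_on_def)

lemma Root_in [simp]: "Root \<in> nodes"
  and Vert_in [simp]: "Vert x \<in> nodes \<longleftrightarrow> x \<in> U"
  and Leaf_in [simp]: "Leaf e \<in> nodes \<longleftrightarrow> e \<in> edges G"
  by (auto simp: nodes_def)

fun up_node :: "('v, 'e) node \<Rightarrow> ('v, 'e) node" where
  "up_node Root = Root"
| "up_node (Vert x) = (if anc x = {} then Root else Vert (parent x))"
| "up_node (Leaf e) = (if e = e0 then Root else Vert (low e))"

fun depth :: "('v, 'e) node \<Rightarrow> nat" where
  "depth Root = 0"
| "depth (Vert x) = Suc (card (anc x))"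
| "depth (Leaf e) = (if e = e0 then 1 else Suc (Suc (card (anc (low e)))))"

lemma finite_edges: "finite (edges G)"
  using graph by (simp add: finite_mgraph_def)

lemma up_self: "x \<in> up x" by (simp add: up_def)

lemma up_subset: "x \<in> W \<Longrightarrow> up x \<subseteq> W"
  using anc_subset by (auto simp: up_def)

lemma up_trans: "x \<in> W \<Longrightarrow> y \<in> up x \<Longrightarrow> up y \<subseteq> up x"
  using anc_trans by (auto simp: up_def)

lemma up_parent:
  assumes "x \<in> W" "anc x \<noteq> {}"
  shows "parent x \<in> W" "up x = insert x (up (parent x))" "card (anc x) = Suc (card (anc (parent x)))"
proof -
  have x: "x \<in> W - roots" using assms by (simp add: roots_def)
  show "parent x \<in> W" "card (anc x) = Suc (card (anc (parent x)))"
    using par_in[OF x] dep_par[OF x] by auto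
  show "up x = insert x (up (parent x))" using parent[OF assms] by (auto simp: up_def)
qed

lemma card_up: "x \<in> W \<Longrightarrow> card (up x) \<le> t"
  unfolding up_def using card_anc[of x] finite_anc[of x] card_insert_le_m1[of t "anc x" x] by simp

lemma finite_up: "x \<in> W \<Longrightarrow> finite (up x)"
  using finite_anc by (simp add: up_def)

lemma U_up:
  assumes "x \<in> U" "y \<in> up x" shows "y \<in> U"
proof -
  obtain e where "e \<in> edges G - {e0}" "x \<in> up (low e)" "x \<in> W"
    using assms(1) by (auto simp: U_def)
  then show ?thesis
    using assms(2) up_trans[of "low e" x] low[of e] up_subset[of x] by (auto simp: U_def)
qed

lemma low_U: "e \<in> edges G \<Longrightarrow> e \<noteq> e0 \<Longrightarrow> low e \<in> U"
  using low up_self by (auto simp: U_def)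

lemma U_W: "x \<in> U \<Longrightarrow> x \<in> W" by (simp add: U_def)

lemma parent_U: "x \<in> U \<Longrightarrow> anc x \<noteq> {} \<Longrightarrow> parent x \<in> U"
  using U_up[of x "parent x"] up_parent(2)[of x] U_W[of x] up_self[of "parent x"] by simp

lemma up_node_in:
  assumes "a \<in> nodes" shows "up_node a \<in> nodes"
  using assms low_U parent_U by (cases a) auto

lemma depth_up_node:
  assumes "a \<in> nodes" "a \<noteq> Root" shows "depth a = Suc (depth (up_node a))"
  using assms up_parent(3) U_W by (cases a) auto

sublocale T: parent_forest "emb ` nodes" "{emb Root}" "\<lambda>n. emb (up_node (inv_into nodes emb n))"
  "\<lambda>n. depth (inv_into nodes emb n)"
proof
  have "finite U" using finite_vertices by (simp add: U_def)
  then show "finite (emb ` nodes)" using finite_edges by (simp add: nodes_def)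
  show "emb (up_node (inv_into nodes emb x)) \<in> emb ` nodes" if "x \<in> emb ` nodes - {emb Root}" for x
    using that up_node_in inj_emb by auto
  show "depth (inv_into nodes emb x) = Suc (depth (inv_into nodes emb (emb (up_node (inv_into nodes emb x)))))"
    if "x \<in> emb ` nodes - {emb Root}" for x
    using that up_node_in depth_up_node inj_emb by auto
qed (use inj_emb in auto)

text \<open>Forest vertices occupy depths 1 to \<open>t\<close> under the new root; the edge leaves
  may need one level more.\<close>

lemma depth_le: "a \<in> nodes \<Longrightarrow> depth a \<le> t + 1"
proof (cases a)
  case (Vert x)
  then show "a \<in> nodes \<Longrightarrow> ?thesis" using card_anc[of x] U_W by (auto simp: nodes_def)
next
  case (Leaf e)
  then show "a \<in> nodes \<Longrightarrow> ?thesis" using card_anc[of "low e"] low by (auto simp: nodes_def)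
qed auto

lemma radius: "radius (emb ` nodes) T.F \<le> t + 1"
  by (rule T.radius_le) (use depth_le inj_emb in auto)

lemma tree: "tree (emb ` nodes) T.F"
  by (rule T.treeI) simp

text \<open>This is the effect of the pruning: below a retained vertex lies some
  \<open>low e\<close> with \<open>e \<noteq> e0\<close>, and the way down to the leaf of
  \<open>e\<close> passes through a child. Having also a parent, the vertex is not a leaf of the
  tree.\<close>

lemma U_child:
  assumes "x \<in> U" shows "\<exists>a\<in>nodes. a \<noteq> Root \<and> up_node a = Vert x"
proof -
  obtain e where e: "e \<in> edges G" "e \<noteq> e0" "x \<in> up (low e)"
    using assms by (auto simp: U_def)
  have *: "\<exists>a\<in>nodes. a \<noteq> Root \<and> up_node a = Vert x" if "z \<in> U" "x \<in> anc z" for z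
    using that
  proof (induction "card (anc z)" arbitrary: z)
    case 0
    then show ?case using finite_anc U_W by force
  next
    case (Suc n)
    then have z: "z \<in> W" "anc z \<noteq> {}" using U_W by auto
    show ?case
    proof (cases "x = parent z")
      case True
      then show ?thesis using Suc.prems z by (intro bexI[of _ "Vert z"]) (auto simp: nodes_def)
    next
      case False
      then have "x \<in> anc (parent z)" using parent(2)[OF z] Suc.prems by auto
      then show ?thesis
        using Suc.hyps(1)[of "parent z"] Suc.hyps(2) up_parent(3)[OF z] parent_U Suc.prems(1) z by auto
    qed
  qed
  show ?thesis
  proof (cases "x = low e")
    case True
    then show ?thesis using e by (intro bexI[of _ "Leaf e"]) (auto simp: nodes_def)
  next
    case False
    then show ?thesis using * low_U e by (auto simp: up_def)
  qed
qed

lemma Root_child: "\<exists>x\<in>U. anc x = {}"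
proof -
  have "\<exists>x\<in>U. anc x = {}" if "z \<in> U" for z
    using that
  proof (induction "card (anc z)" arbitrary: z)
    case 0
    then show ?case using finite_anc U_W by force
  next
    case (Suc n)
    then have "anc z \<noteq> {}" by auto
    then show ?case
      using Suc up_parent(3) parent_U U_W by (metis Suc_inject)
  qed
  then show ?thesis using low_U e1 by blast
qed

lemma leaves: "leaves (emb ` nodes) T.F = (\<lambda>e. emb (Leaf e)) ` edges G"
proof -
  have emb: "emb a \<in> emb ` nodes - {emb Root}" if "a \<in> nodes" "a \<noteq> Root" for a
    using that by simp
  have 1: "emb (Leaf e) \<in> leaves (emb ` nodes) T.F" if "e \<in> edges G" for e
  proof (rule T.leafI)
    show "emb (Leaf e) \<in> emb ` nodes - {emb Root}" using that by simp
    show "emb (up_node (inv_into nodes emb y)) \<noteq> emb (Leaf e)"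
      if y: "y \<in> emb ` nodes - {emb Root}" for y
    proof -
      obtain a where a: "a \<in> nodes" "y = emb a" using y by blast
      have "up_node a \<noteq> Leaf e" by (cases a) auto
      then show ?thesis using a inj_emb up_node_in \<open>e \<in> edges G\<close> by simp
    qed
  qed
  have 2: "emb (Vert x) \<notin> leaves (emb ` nodes) T.F" if x: "x \<in> U" for x
  proof -
    obtain a where a: "a \<in> nodes" "a \<noteq> Root" "up_node a = Vert x" using U_child[OF x] by blast
    have "a \<noteq> Vert x" using a depth_up_node[OF a(1,2)] by auto
    then show ?thesis
      using T.two_edges_not_leaf[of "emb (Vert x)" "emb a" "emb (Vert x)"] a x emb inj_emb by auto
  qed
  have 3: "emb Root \<notin> leaves (emb ` nodes) T.F"
  proof -
    obtain x where "x \<in> U" "anc x = {}" using Root_child by blast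
    then show ?thesis
      using T.two_edges_not_leaf[of "emb (Vert x)" "emb (Leaf e0)" "emb Root"] e0 emb inj_emb by auto
  qed
  have "leaves (emb ` nodes) T.F \<subseteq> emb ` nodes" by (auto simp: leaves_def)
  then show ?thesis using 1 2 3 by (auto simp: nodes_def)
qed

section \<open>Components of the decomposition tree after deleting a node\<close>

definition J where
  "J m a b = joined (emb ` nodes - {emb m}) {e \<in> T.F. emb m \<notin> e} (emb a) (emb b)"

lemma J_step:
  assumes "m \<in> nodes" "a \<in> nodes" "a \<noteq> Root" "a \<noteq> m" "up_node a \<noteq> m"
  shows "J m a (up_node a)"
proof -
  have a: "emb a \<in> emb ` nodes - {emb Root}" using assms by auto
  show ?thesis
    unfolding J_def
    using T.edge_par(1)[OF a] up_node_in[OF assms(2)] assms inj_emb by (intro joined_edge) auto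
qed

lemma J_refl: "m \<in> nodes \<Longrightarrow> a \<in> nodes \<Longrightarrow> a \<noteq> m \<Longrightarrow> J m a a"
  unfolding J_def by (intro joined_refl) auto

lemma J_sym: "J m a b \<Longrightarrow> J m b a"
  unfolding J_def by (rule joined_sym)

lemma J_trans: "J m a b \<Longrightarrow> J m b c \<Longrightarrow> J m a c"
  unfolding J_def by (rule joined_trans)

text \<open>The climb from \<open>z\<close> to its ancestor \<open>x\<close> is cut only if
  \<open>m\<close> is one of the vertices between them, both included.\<close>

lemma J_up:
  assumes "m \<in> nodes" "z \<in> U" "x \<in> up z" "\<And>w. m = Vert w \<Longrightarrow> w \<in> up z \<Longrightarrow> x \<in> up w \<Longrightarrow> False"
  shows "J m (Vert z) (Vert x)"
  using assms
proof (induction "card (anc z)" arbitrary: z)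
  case 0
  then have "x = z" using finite_anc U_W by (auto simp: up_def)
  then show ?case using 0 up_self J_refl[of m "Vert z"] by auto
next
  case (Suc n)
  show ?case
  proof (cases "x = z")
    case True
    then show ?thesis using Suc.prems up_self J_refl[of m "Vert z"] by auto
  next
    case False
    then have z: "z \<in> W" "anc z \<noteq> {}" using Suc.prems U_W by (auto simp: up_def)
    have x: "x \<in> up (parent z)" using False Suc.prems(3) up_parent(2)[OF z] by auto
    have "J m (Vert (parent z)) (Vert x)"
    proof (rule Suc.hyps(1))
      show "n = card (anc (parent z))" using Suc.hyps(2) up_parent(3)[OF z] by simp
      show "parent z \<in> U" using parent_U Suc.prems(2) z by blast
      show False if "m = Vert w" "w \<in> up (parent z)" "x \<in> up w" for w
        using Suc.prems(4)[of w] that up_parent(2)[OF z] by auto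
    qed (use x Suc.prems(1) in simp_all)
    moreover have "J m (Vert z) (up_node (Vert z))"
      using z Suc.prems(1,2,3) Suc.prems(4)[of z] Suc.prems(4)[of "parent z"] x up_parent(2)[OF z] up_self
      by (intro J_step) (auto simp: nodes_def)
    ultimately show ?thesis using z J_trans by auto
  qed
qed

lemma J_root:
  assumes "m \<in> nodes" "z \<in> U" "m \<noteq> Root" "\<And>w. w \<in> up z \<Longrightarrow> m \<noteq> Vert w"
  shows "J m (Vert z) Root"
  using assms
proof (induction "card (anc z)" arbitrary: z)
  case 0
  then have "anc z = {}" using finite_anc U_W by auto
  then show ?case using J_step[of m "Vert z"] 0 up_self by (auto simp: nodes_def)
next
  case (Suc n)
  then have z: "z \<in> W" "anc z \<noteq> {}" using U_W by auto
  have "J m (Vert (parent z)) Root"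
    by (rule Suc.hyps(1)) (use Suc.prems Suc.hyps(2) z up_parent[OF z] parent_U in auto)
  moreover have "J m (Vert z) (up_node (Vert z))"
    using z Suc.prems up_parent(2)[OF z] up_self by (intro J_step) (auto simp: nodes_def)
  ultimately show ?case using z J_trans by auto
qed

text \<open>Designed to contain every boundary vertex at an internal node \<open>m\<close>. For
  \<open>Vert x\<close> these are on the chain of \<open>x\<close>, except that \<open>e0\<close>
  hangs at the root rather than below \<open>low e0\<close>, so its ends can also be on the boundary
  at the root and at vertices of its own chain. There \<open>up (low e0)\<close> covers everything.
  The set is always a single chain, hence has at most \<open>t\<close> elements.\<close>

fun chain :: "('v, 'e) node \<Rightarrow> 'v set" where
  "chain (Vert x) = (if x \<in> up (low e0) then up (low e0) else up x)"
| "chain _ = up (low e0)"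

lemma ends_up: "e \<in> edges G \<Longrightarrow> y \<in> ends G e \<Longrightarrow> y \<in> up (low e)"
  using ends_low by (auto simp: up_def)

text \<open>Outside \<open>chain m\<close> the link from an edge to its end \<open>y\<close> avoids
  \<open>m\<close>: it climbs from \<open>low e\<close>, or, for \<open>e0\<close>, goes through the
  root and down to \<open>y\<close>.\<close>

lemma J_leaf_end:
  assumes "e \<in> edges G" "y \<in> ends G e" "y \<in> U" "y \<notin> chain m" "m \<in> nodes" "\<And>e. m \<noteq> Leaf e"
  shows "J m (Leaf e) (Vert y)"
proof (cases "e = e0")
  case True
  then have y: "y \<in> up (low e0)" using assms ends_up by auto
  then obtain x where m: "m = Vert x" "x \<notin> up (low e0)"
    using assms(4,6) by (cases m) (auto split: if_splits)
  have "J m (Leaf e) Root"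
    using J_step[of m "Leaf e"] assms(1,5) m True by (auto simp: nodes_def)
  moreover have "J m (Vert y) Root"
    using J_root[OF assms(5,3)] m up_trans[OF low[OF e0] y] by auto
  ultimately show ?thesis using J_sym J_trans by blast
next
  case False
  have low': "low e \<in> U" "y \<in> up (low e)" using low_U ends_up assms False by auto
  have m: False if "m = Vert w" "y \<in> up w" for w
    using that assms(4) up_trans[OF low[OF e0], of w] by (auto split: if_splits)
  have "J m (Leaf e) (Vert (low e))"
    using J_step[of m "Leaf e"] assms(1,5,6) m[of "low e"] low' False by (auto simp: nodes_def)
  moreover have "J m (Vert (low e)) (Vert y)"
    using J_up[OF assms(5) low'] m by blast
  ultimately show ?thesis using J_trans by blast
qed

text \<open>For \<open>y\<close> outside \<open>chain m\<close>, the leaves of all edges at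
  \<open>y\<close> lie in the component of \<open>Vert y\<close>, so no union of parts has
  \<open>y\<close> on its boundary.\<close>

lemma node_width:
  assumes m: "m \<in> nodes" "\<And>e. m \<noteq> Leaf e"
    and P: "P \<subseteq> node_partition (edges G) (emb ` nodes) T.F (\<lambda>e. emb (Leaf e)) (emb m)"
  shows "graph_connectivity G (\<Union>P) \<le> int t"
proof -
  let ?B = "{v \<in> verts G. (\<exists>e\<in>\<Union>P. v \<in> ends G e) \<and> (\<exists>e\<in>edges G - \<Union>P. v \<in> ends G e)}"
  have "?B \<subseteq> chain m"
  proof
    fix y assume "y \<in> ?B"
    then obtain e f X where e: "X \<in> P" "e \<in> X" "y \<in> ends G e" and f: "f \<in> edges G" "f \<notin> \<Union>P" "y \<in> ends G f"
      by blast
    obtain C where C: "C \<in> components (emb ` nodes - {emb m}) {e \<in> T.F. emb m \<notin> e}"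
      and X: "X = {e \<in> edges G. emb (Leaf e) \<in> C}"
      using e(1) P unfolding node_partition_def by blast
    have eG: "e \<in> edges G" using e X by blast
    show "y \<in> chain m"
    proof (rule ccontr)
      assume y: "y \<notin> chain m"
      have "e \<noteq> f" using e f by blast
      \<comment> \<open>Of two distinct edges at \<open>y\<close> one is not \<open>e0\<close>, so
        \<open>y\<close> survives the pruning and \<open>Vert y\<close> is a node.\<close>
      then have "y \<in> U"
        using e f eG ends_up low up_subset unfolding U_def by blast
      then have "J m (Leaf e) (Leaf f)"
        using J_leaf_end[OF eG e(3) _ y m] J_leaf_end[OF f(1,3) _ y m] J_sym J_trans by blast
      then have "emb (Leaf f) \<in> C"
        using C e(2) X unfolding components_def J_def by (auto intro: joined_trans)
      then show False using f e(1) X by blast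
    qed
  qed
  moreover have "finite (chain m) \<and> card (chain m) \<le> t"
    using m card_up finite_up low e0 U_W by (cases m) (auto simp: nodes_def)
  ultimately have "card ?B \<le> t" using card_mono[of "chain m" ?B] by linarith
  then show ?thesis by (simp add: graph_connectivity_def)
qed

lemma kr_decomposition:
  "kr_decomposition (edges G) (graph_connectivity G) (t + 1) (t + 1) (emb ` nodes) T.F (\<lambda>e. emb (Leaf e))"
proof -
  let ?\<sigma> = "\<lambda>e. emb (Leaf e)"
  have int: "internal_nodes (emb ` nodes) T.F = emb ` (nodes - range Leaf)"
    unfolding internal_nodes_def leaves by auto
  have R: "Root \<in> nodes - range Leaf" by (auto simp: nodes_def)
  have "finite nodes" using T.finite_V inj_emb by (rule finite_imageD)
  have dec: "decomposition (edges G) (emb ` nodes) T.F ?\<sigma>"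
    unfolding decomposition_def leaves int
  proof (intro conjI tree)
    show "emb ` (nodes - range Leaf) \<noteq> {}" using R by blast
    show "bij_betw ?\<sigma> (edges G) (?\<sigma> ` edges G)"
      by (auto simp: bij_betw_def inj_on_def)
  qed
  have w: "node_width (edges G) (graph_connectivity G) (emb ` nodes) T.F ?\<sigma> (emb m) \<le> int t"
    if "m \<in> nodes - range Leaf" for m
  proof -
    have "finite (node_partition (edges G) (emb ` nodes) T.F ?\<sigma> (emb m))"
      unfolding node_partition_def components_def using T.finite_V by auto
    then show ?thesis
      unfolding node_width_def using node_width[of m] that by (subst Max_le_iff) auto
  qed
  have "width (edges G) (graph_connectivity G) (emb ` nodes) T.F ?\<sigma> \<le> int t"
    unfolding width_def int
  proof (subst Max_le_iff)
    show "finite (node_width (edges G) (graph_connectivity G) (emb ` nodes) T.F ?\<sigma> ` emb ` (nodes - range Leaf))"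
      using \<open>finite nodes\<close> by simp
    show "node_width (edges G) (graph_connectivity G) (emb ` nodes) T.F ?\<sigma> ` emb ` (nodes - range Leaf) \<noteq> {}"
      using R by blast
  qed (use w in blast)
  then show ?thesis using dec radius by (simp add: kr_decomposition_def)
qed

end

lemma decomposition_from_tree_depth:
  fixes G :: "('v, 'e) mgraph"
  assumes G: "finite_mgraph G" and E: "2 \<le> card (edges G)"
  shows "\<exists>(V :: nat set) F \<sigma>. kr_decomposition (edges G) (graph_connectivity G)
    (graph_tree_depth G + 1) (graph_tree_depth G + 1) V F \<sigma>"
proof -
  let ?t = "graph_tree_depth G"
  have "finite (verts G)" using G by (simp add: finite_mgraph_def)
  moreover have "e \<subseteq> verts G \<and> card e = 2" if "e \<in> simplification_edges G" for e
    using that G by (auto simp: simplification_edges_def finite_mgraph_def)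
  ultimately obtain W anc where W: "tree_order W anc" "verts G \<subseteq> W"
    "\<forall>x\<in>W. card (anc x) < ?t"
    "\<forall>e\<in>simplification_edges G. \<exists>x\<in>W. \<exists>y\<in>anc x. e = {y, x}"
    unfolding graph_tree_depth_def using simple_tree_depth_order by metis
  \<comment> \<open>Two distinct ends are comparable and the lower one serves; for a loop it is the
    only end.\<close>
  have "\<exists>x. x \<in> W \<and> ends G e \<subseteq> insert x (anc x)" if e: "e \<in> edges G" for e
  proof (cases "card (ends G e) = 2")
    case True
    then have "ends G e \<in> simplification_edges G" using e by (auto simp: simplification_edges_def)
    then obtain x y where "x \<in> W" "y \<in> anc x" "ends G e = {y, x}" using W(4) by auto
    then show ?thesis by auto
  next
    case False
    then have "card (ends G e) = 1" "ends G e \<subseteq> verts G"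
      using G e by (auto simp: finite_mgraph_def)
    then show ?thesis using W(2) by (auto simp: card_1_singleton_iff)
  qed
  then obtain low where low: "\<And>e. e \<in> edges G \<Longrightarrow> low e \<in> W \<and> ends G e \<subseteq> insert (low e) (anc (low e))"
    by metis
  have E0: "edges G \<noteq> {}" using E by auto
  then obtain e0 where e0: "e0 \<in> edges G" by blast
  have "edges G \<noteq> {e0}" using E by auto
  then obtain e1 where e1: "e1 \<in> edges G" "e1 \<noteq> e0" using e0 by blast
  have "finite (insert Root (Vert ` W \<union> Leaf ` edges G))"
    using W(1) G by (auto simp: tree_order_def finite_mgraph_def)
  then obtain emb :: "('v, 'e) node \<Rightarrow> nat" where "inj_on emb (insert Root (Vert ` W \<union> Leaf ` edges G))"
    using finite_imp_inj_to_nat_seg by metis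
  then interpret forest_decomposition W anc G ?t low e0 e1 emb
    using W low e0 e1 G by (auto simp: forest_decomposition_def forest_decomposition_axioms_def)
  show ?thesis using kr_decomposition by blast
qed

section \<open>Dominators in a rooted tree\<close>

lemma leaf_edge_unique:
  assumes "v \<in> leaves V F" "{a, v} \<in> F" "{b, v} \<in> F"
  shows "a = b"
proof -
  have "card {e \<in> F. v \<in> e} = 1" using assms(1) by (simp add: leaves_def)
  then obtain e where "{e \<in> F. v \<in> e} = {e}" by (auto simp: card_1_singleton_iff)
  moreover have "{a, v} \<in> {e \<in> F. v \<in> e}" "{b, v} \<in> {e \<in> F. v \<in> e}" using assms(2,3) by auto
  ultimately have "{a, v} = {b, v}" by (metis singletonD)
  then show ?thesis by (auto simp: doubleton_eq_iff)
qed

locale centred_tree =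
  fixes V :: "'n set" and F :: "'n set set" and c :: 'n
  assumes tree: "tree V F" and c: "c \<in> V"
begin

text \<open>
  In a tree, \<open>dom u v\<close> says that \<open>u\<close> lies on the path from \<open>c\<close> to \<open>v\<close>. With all walks in place of
  the unique path, the order properties need no acyclicity.
\<close>

definition dom :: "'n \<Rightarrow> 'n \<Rightarrow> bool" where
  "dom u v \<longleftrightarrow> (\<forall>p. walk V F p \<and> hd p = c \<and> last p = v \<longrightarrow> u \<in> set p)"

lemma domD: "dom u v \<Longrightarrow> walk V F p \<Longrightarrow> hd p = c \<Longrightarrow> last p = v \<Longrightarrow> u \<in> set p"
  by (simp add: dom_def)

lemma walk_from_c:
  assumes "v \<in> V"
  obtains p where "walk V F p" "hd p = c" "last p = v"
  using tree c assms unfolding tree_def joined_def by blast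

lemma dom_refl: "dom v v"
  by (auto simp: dom_def walk_def)

lemma dom_root: "dom c v"
  by (auto simp: dom_def walk_def)

lemma dom_trans:
  assumes "dom a b" "dom b v" shows "dom a v"
  unfolding dom_def
proof (intro allI impI)
  fix p assume p: "walk V F p \<and> hd p = c \<and> last p = v"
  then have "b \<in> set p" using domD[OF assms(2)] by blast
  then obtain xs ys where s: "p = xs @ b # ys" by (metis split_list)
  have "walk V F (xs @ [b])" using walk_prefix(1)[of V F xs b ys] p s by simp
  moreover have "hd (xs @ [b]) = c" using p s by (cases xs) auto
  ultimately have "a \<in> set (xs @ [b])" using domD[OF assms(1), of "xs @ [b]"] by simp
  then show "a \<in> set p" using s by auto
qed

text \<open>A walk cut at its first visit to \<open>a\<close> must have met \<open>b\<close> before;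
  its part up to \<open>b\<close> reaches \<open>b\<close> without \<open>a\<close>.\<close>

lemma dom_antisym:
  assumes "dom a b" "dom b a" "a \<in> V" shows "a = b"
proof (rule ccontr)
  assume "a \<noteq> b"
  obtain p where p: "walk V F p" "hd p = c" "last p = a" using walk_from_c[OF assms(3)] .
  have "a \<in> set p" using p by (auto simp: walk_def)
  then obtain xs ys where s: "p = xs @ a # ys" "a \<notin> set xs" by (metis split_list_first)
  have w: "walk V F (xs @ [a])" using walk_prefix(1)[of V F xs a ys] p s by simp
  have "hd (xs @ [a]) = c" using p s by (cases xs) auto
  then have "b \<in> set xs" using domD[OF assms(2) w] \<open>a \<noteq> b\<close> by simp
  then obtain us ws where u: "xs = us @ b # ws" by (metis split_list)
  have "walk V F (us @ [b])" using walk_prefix(1)[of V F us b "ws @ [a]"] w u by simp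
  moreover have "hd (us @ [b]) = c" using p s u by (cases us) auto
  ultimately have "a \<in> set (us @ [b])" using domD[OF assms(1), of "us @ [b]"] by simp
  then show False using u s(2) \<open>a \<noteq> b\<close> by auto
qed

text \<open>Consider the last visit to \<open>a\<close> or \<open>b\<close> on a walk to
  \<open>v\<close>. If the other node did not dominate the one visited, the beginning could be
  rerouted around it, and the tail misses it anyway.\<close>

lemma dom_chain:
  assumes "v \<in> V" "dom a v" "dom b v" shows "dom a b \<or> dom b a"
proof (rule ccontr)
  assume neg: "\<not> (dom a b \<or> dom b a)"
  obtain w where w: "walk V F w" "hd w = c" "last w = v" using walk_from_c[OF assms(1)] .
  have "\<exists>z\<in>set w. z = a \<or> z = b" using domD[OF assms(2) w] by blast
  then obtain xs y ys where s: "w = xs @ y # ys" "y = a \<or> y = b" "\<forall>z\<in>set ys. \<not> (z = a \<or> z = b)"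
    using split_list_last_prop[of w "\<lambda>z. z = a \<or> z = b"] by blast
  have tail: "walk V F (y # ys)" "last (y # ys) = v"
    using walk_prefix(2)[of V F xs y ys] w s(1) by auto
  have False if y: "y = d" "\<not> dom d' d" "dom d' v" "d' \<notin> set ys" for d d'
  proof -
    obtain q where q: "walk V F q" "hd q = c" "last q = y" "d' \<notin> set q"
      using y(1,2) unfolding dom_def by blast
    have "last q = hd (y # ys)" using q by simp
    note W = walk_append[OF q(1) tail(1) this]
    have "d' \<in> set (q @ tl (y # ys))"
      by (rule domD[OF y(3) W(1)]) (use W q tail in auto)
    then show False using q y by simp
  qed
  then show False using s neg assms by blast
qed

lemma dom_greatest:
  assumes "finite A" "A \<noteq> {}" "\<And>a b. a \<in> A \<Longrightarrow> b \<in> A \<Longrightarrow> dom a b \<or> dom b a"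
  shows "\<exists>d\<in>A. \<forall>u\<in>A. dom u d"
  using assms
proof (induction rule: finite_ne_induct)
  case (singleton x)
  then show ?case using dom_refl by simp
next
  case (insert x A)
  then obtain d where d: "d \<in> A" "\<forall>u\<in>A. dom u d" by blast
  show ?case
  proof (cases "dom x d")
    case True
    then show ?thesis using d by blast
  next
    case False
    then have "dom d x" using insert.prems d(1) by blast
    then have "\<forall>u\<in>insert x A. dom u x" using d(2) dom_trans dom_refl by blast
    then show ?thesis by blast
  qed
qed

definition lca :: "'n set \<Rightarrow> 'n" where
  "lca L = (SOME d. d \<in> V \<and> (\<forall>l\<in>L. dom d l) \<and> (\<forall>u\<in>V. (\<forall>l\<in>L. dom u l) \<longrightarrow> dom u d))"

lemma lca:
  assumes "L \<noteq> {}" "L \<subseteq> V"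
  shows "lca L \<in> V" "\<And>l. l \<in> L \<Longrightarrow> dom (lca L) l"
    "\<And>u. u \<in> V \<Longrightarrow> (\<And>l. l \<in> L \<Longrightarrow> dom u l) \<Longrightarrow> dom u (lca L)"
proof -
  let ?A = "{u \<in> V. \<forall>l\<in>L. dom u l}"
  obtain l where l: "l \<in> L" "l \<in> V" using assms by blast
  have "finite V" using tree by (simp add: tree_def forest_def simple_graph_def)
  then have "finite ?A" by simp
  moreover have "?A \<noteq> {}" using c dom_root by blast
  moreover have "dom a b \<or> dom b a" if "a \<in> ?A" "b \<in> ?A" for a b
    using dom_chain[OF l(2)] that l(1) by simp
  ultimately have "\<exists>d\<in>?A. \<forall>u\<in>?A. dom u d" by (rule dom_greatest)
  then have "\<exists>d. d \<in> V \<and> (\<forall>l\<in>L. dom d l) \<and> (\<forall>u\<in>V. (\<forall>l\<in>L. dom u l) \<longrightarrow> dom u d)" by auto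
  from someI_ex[OF this]
  have "lca L \<in> V \<and> (\<forall>l\<in>L. dom (lca L) l) \<and> (\<forall>u\<in>V. (\<forall>l\<in>L. dom u l) \<longrightarrow> dom u (lca L))"
    unfolding lca_def .
  then show "lca L \<in> V" "\<And>l. l \<in> L \<Longrightarrow> dom (lca L) l"
    "\<And>u. u \<in> V \<Longrightarrow> (\<And>l. l \<in> L \<Longrightarrow> dom u l) \<Longrightarrow> dom u (lca L)" by blast+
qed

lemma walk_last_exit:
  assumes "walk V F p" "d \<in> set p" "last p \<noteq> d"
  shows "\<exists>d' q. walk V F (d' # q) \<and> {d', d} \<in> F \<and> d \<notin> set (d' # q) \<and> last (d' # q) = last p
    \<and> d' \<in> set p"
proof -
  obtain xs ys where s: "p = xs @ d # ys" "d \<notin> set ys"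
    using assms(2) by (metis split_list_last)
  then obtain d' q where y: "ys = d' # q" using assms(3) by (cases ys) auto
  have "walk V F (d # d' # q)" using walk_prefix(2)[of V F xs d ys] assms(1) s y by simp
  then have "walk V F (d' # q)" "{d', d} \<in> F" by (auto simp: walk_def insert_commute)
  then show ?thesis using s y by (intro exI[of _ d'] exI[of _ q]) auto
qed

text \<open>If \<open>L\<close> lies in one component of the tree minus \<open>d\<close>, acyclicity
  leaves a single neighbour \<open>d'\<close> of \<open>d\<close> attached to that component. Every
  walk from \<open>c\<close> to \<open>L\<close> leaves \<open>d\<close> for the last time through
  \<open>d'\<close>, so \<open>d'\<close> is a lower common dominator.\<close>

lemma dom_step:
  assumes "L \<noteq> {}" "\<And>l. l \<in> L \<Longrightarrow> l \<in> V \<and> l \<noteq> d \<and> dom d l"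
    and conn: "\<And>l l'. l \<in> L \<Longrightarrow> l' \<in> L \<Longrightarrow> joined (V - {d}) {e \<in> F. d \<notin> e} l l'"
  shows "\<exists>d'\<in>V. d' \<noteq> d \<and> dom d d' \<and> (\<forall>l\<in>L. dom d' l)"
proof -
  have exit: "\<exists>d' q. walk V F (d' # q) \<and> {d', d} \<in> F \<and> d \<notin> set (d' # q) \<and> last (d' # q) = l \<and> d' \<in> set p"
    if "l \<in> L" "walk V F p" "hd p = c" "last p = l" for l p
    using walk_last_exit[OF that(2), of d] domD[of d l p] assms(2)[OF that(1)] that by auto
  obtain l where l: "l \<in> L" using assms(1) by blast
  then obtain p where p: "walk V F p" "hd p = c" "last p = l" using walk_from_c assms(2) by metis
  obtain d' q where q: "walk V F (d' # q)" "{d', d} \<in> F" "d \<notin> set (d' # q)" "last (d' # q) = l"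
    using exit[OF l p] by blast
  have joined: "joined (V - {d}) {e \<in> F. d \<notin> e} d' l"
    unfolding joined_avoiding using q by (intro exI[of _ "d' # q"]) simp
  have "dom d' l'" if l': "l' \<in> L" for l'
    unfolding dom_def
  proof (intro allI impI)
    fix w assume w: "walk V F w \<and> hd w = c \<and> last w = l'"
    then obtain b r where r: "walk V F (b # r)" "{b, d} \<in> F" "d \<notin> set (b # r)" "last (b # r) = l'" "b \<in> set w"
      using exit[OF l', of w] by blast
    have "joined (V - {d}) {e \<in> F. d \<notin> e} b l'"
      unfolding joined_avoiding using r by (intro exI[of _ "b # r"]) simp
    then have "joined (V - {d}) {e \<in> F. d \<notin> e} d' b"
      by (rule joined_trans[OF joined_trans[OF joined conn[OF l l']] joined_sym])
    then obtain s where "walk V F s" "d \<notin> set s" "hd s = d'" "last s = b"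
      unfolding joined_avoiding by blast
    then have "d' = b"
      using forest_neighbour_unique[of V F d' d b s] tree q(2) r(2) by (simp add: tree_def)
    then show "d' \<in> set w" using r by simp
  qed
  moreover have "d' \<in> V" "d' \<noteq> d" using q by (auto simp: walk_def)
  moreover have "dom d d'"
    unfolding dom_def
  proof (intro allI impI)
    fix w assume w: "walk V F w \<and> hd w = c \<and> last w = d'"
    then have eq: "last w = hd (d' # q)" by simp
    note W = walk_append[OF _ q(1) eq]
    have "d \<in> set (w @ tl (d' # q))"
      by (rule domD[of d l]) (use W w q assms(2)[OF l] in auto)
    then show "d \<in> set w" using q(3) by simp
  qed
  ultimately show ?thesis by blast
qed

text \<open>Otherwise \<open>dom_step\<close> yields a common dominator strictly below the lowest
  one. This is what puts the edges of a vertex into different parts at its place.\<close>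

lemma lca_separates:
  assumes "L \<noteq> {}" "L \<subseteq> V" "lca L \<notin> L"
  shows "\<exists>l\<in>L. \<exists>l'\<in>L. \<not> joined (V - {lca L}) {e \<in> F. lca L \<notin> e} l l'"
proof (rule ccontr)
  assume "\<not> ?thesis"
  then obtain d' where d': "d' \<in> V" "d' \<noteq> lca L" "dom (lca L) d'" "\<forall>l\<in>L. dom d' l"
    using dom_step[of L "lca L"] assms lca(2)[OF assms(1,2)] by blast
  then have "dom d' (lca L)" using lca(3)[OF assms(1,2)] by blast
  then show False using dom_antisym d' by blast
qed

text \<open>A walk enters and leaves a leaf through the same neighbour, so the visit can be skipped;
  \<open>d \<noteq> c\<close> guarantees that it enters.\<close>

lemma leaf_dom:
  assumes "d \<in> leaves V F" "d \<noteq> c" "l \<in> V" "dom d l"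
  shows "l = d"
proof (rule ccontr)
  assume "l \<noteq> d"
  obtain p where p: "walk V F p" "hd p = c" "last p = l" using walk_from_c[OF assms(3)] .
  have dp: "d \<in> set p" using domD[OF assms(4) p] .
  then obtain xs ys where s: "p = xs @ d # ys" "d \<notin> set xs" by (metis split_list_first)
  have "xs \<noteq> []" using s p assms(2) by auto
  then have xs: "walk V F xs" "{last xs, d} \<in> F" "hd xs = c"
    using p s by (auto simp: walk_def successively_append_iff)
  obtain d' q where q: "walk V F (d' # q)" "{d', d} \<in> F" "d \<notin> set (d' # q)" "last (d' # q) = l"
    using walk_last_exit[OF p(1) dp] p \<open>l \<noteq> d\<close> by auto
  have "last xs = d'" using leaf_edge_unique[OF assms(1) xs(2) q(2)] .
  then have eq: "last xs = hd (d' # q)" by simp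
  note W = walk_append[OF xs(1) q(1) eq]
  have "d \<in> set (xs @ tl (d' # q))"
    by (rule domD[OF assms(4) W(1)]) (use W xs q in auto)
  then show False using s q by simp
qed

end

section \<open>Centres of a tree\<close>

lemma radius_centre:
  assumes "tree V F"
  shows "\<exists>u\<in>V. \<forall>w\<in>V. distance V F u w \<le> radius V F"
  unfolding radius_def
proof (rule LeastI_ex)
  obtain u where "u \<in> V" using assms by (auto simp: tree_def)
  moreover have "finite V" using assms by (simp add: tree_def forest_def simple_graph_def)
  ultimately show "\<exists>r. \<exists>u\<in>V. \<forall>w\<in>V. distance V F u w \<le> r"
    by (intro exI[of _ "Max (distance V F u ` V)"] bexI[of _ u]) auto
qed

text \<open>If the centre is a leaf, its only neighbour takes over. Walks to other leaves get
  shorter, the old centre is at distance one, and the neighbour is internal because the path to some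
  internal node ends at it or continues beyond it.\<close>

lemma internal_centre:
  assumes tree: "tree V F" and int: "internal_nodes V F \<noteq> {}"
  obtains c where "c \<in> internal_nodes V F"
    "\<And>l. l \<in> leaves V F \<Longrightarrow> \<exists>p. walk V F p \<and> hd p = c \<and> last p = l \<and> length p \<le> radius V F + 1"
proof -
  obtain u where u: "u \<in> V" "\<And>w. w \<in> V \<Longrightarrow> distance V F u w \<le> radius V F"
    using radius_centre[OF tree] by blast
  have near: "\<exists>p. walk V F p \<and> hd p = u \<and> last p = w \<and> length p \<le> radius V F + 1" if "w \<in> V" for w
    using distance_walk[of V F u w] u that tree by (fastforce simp: tree_def)
  show ?thesis
  proof (cases "u \<in> leaves V F")
    case False
    then show ?thesis using that[of u] u(1) near by (simp add: internal_nodes_def leaves_def)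
  next
    case True
    obtain v where v: "v \<in> V" "v \<notin> leaves V F" using int by (auto simp: internal_nodes_def)
    then have "v \<noteq> u" using True by blast
    obtain p where p: "walk V F p" "hd p = u" "last p = v" "length p \<le> radius V F + 1"
      using near[OF v(1)] by blast
    obtain q where q: "walk V F q" "distinct q" "hd q = u" "last q = v"
      using walk_distinct[OF p(1)] p by blast
    obtain n q' where n: "q = u # n # q'"
      using q \<open>v \<noteq> u\<close> by (cases q rule: remdups_adj.cases) (auto simp: walk_def)
    have un: "{n, u} \<in> F" "n \<in> V" using q n by (auto simp: walk_def insert_commute)
    have rad: "1 \<le> radius V F"
      using p \<open>v \<noteq> u\<close> by (cases p rule: remdups_adj.cases) (auto simp: walk_def)
    have "n \<notin> leaves V F"
    proof
      assume nl: "n \<in> leaves V F"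
      then have "q' \<noteq> []" using n q v by auto
      then obtain x q'' where x: "q' = x # q''" by (cases q') auto
      have "{x, n} \<in> F" "{u, n} \<in> F" using q n x by (auto simp: walk_def insert_commute)
      then have "x = u" using leaf_edge_unique[OF nl] by blast
      then show False using q(2) n x by simp
    qed
    moreover have "\<exists>p. walk V F p \<and> hd p = n \<and> last p = l \<and> length p \<le> radius V F + 1"
      if l: "l \<in> leaves V F" for l
    proof (cases "l = u")
      case True
      then show ?thesis
        using un u(1) rad by (intro exI[of _ "[n, u]"]) (auto simp: walk_def)
    next
      case False
      obtain p where p: "walk V F p" "hd p = u" "last p = l" "length p \<le> radius V F + 1"
        using near[of l] l by (auto simp: leaves_def)
      obtain m p' where m: "p = u # m # p'"
        using p False by (cases p rule: remdups_adj.cases) (auto simp: walk_def)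
      have "{m, u} \<in> F" using p m by (auto simp: walk_def insert_commute)
      then have "m = n" using leaf_edge_unique[OF True] un by blast
      then show ?thesis using p m by (intro exI[of _ "m # p'"]) (auto simp: walk_def)
    qed
    ultimately show ?thesis using that[of n] un by (simp add: internal_nodes_def)
  qed
qed

section \<open>Counting boundary vertices\<close>

text \<open>Toggling membership of \<open>a\<close> injects the subsets without \<open>bd\<close>
  into those with \<open>bd\<close>: in the former \<open>a\<close> and \<open>b\<close> are not
  separated, and after toggling they are.\<close>

lemma half_of_subsets:
  assumes "finite P" "a \<in> P" "a \<noteq> b" "\<And>Q. Q \<subseteq> P \<Longrightarrow> (a \<in> Q) \<noteq> (b \<in> Q) \<Longrightarrow> bd Q"
  shows "2 ^ card P \<le> 2 * card {Q \<in> Pow P. bd Q}"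
proof -
  let ?B = "{Q \<in> Pow P. bd Q}" and ?N = "{Q \<in> Pow P. \<not> bd Q}"
  let ?f = "\<lambda>Q. if a \<in> Q then Q - {a} else insert a Q"
  have fin: "finite ?B" "finite ?N" using assms(1) by auto
  have "?f ` ?N \<subseteq> ?B"
  proof (intro image_subsetI)
    fix Q assume Q: "Q \<in> ?N"
    then have "(a \<in> Q) = (b \<in> Q)" using assms(4) by blast
    then have "(a \<in> ?f Q) \<noteq> (b \<in> ?f Q)" using assms(3) by auto
    moreover have "?f Q \<subseteq> P" using Q assms(2) by auto
    ultimately show "?f Q \<in> ?B" using assms(4) by blast
  qed
  moreover have "inj_on ?f ?N"
    by (rule inj_onI) (metis Diff_iff insert_Diff insert_ident insertI1 singletonI)
  ultimately have "card ?N \<le> card ?B" using fin card_inj_on_le by blast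
  moreover have "card (?B \<union> ?N) = card ?B + card ?N"
    by (rule card_Un_disjoint[OF fin]) blast
  moreover have "?B \<union> ?N = Pow P" by blast
  ultimately show ?thesis using card_Pow[OF assms(1)] by simp
qed

text \<open>
  A random subset of \<open>P\<close> puts each element of \<open>M\<close> on the boundary with probability at least one
  half, so the expected size of the boundary is at least \<open>card M / 2\<close>; as the empty subset
  has no boundary, the expected size is less than \<open>k\<close>.
\<close>

lemma card_separated_le:
  fixes bd :: "'x \<Rightarrow> 'p set \<Rightarrow> bool"
  assumes "finite P" "finite M"
    and sep: "\<And>x. x \<in> M \<Longrightarrow> \<exists>a\<in>P. \<exists>b. a \<noteq> b \<and> (\<forall>Q\<subseteq>P. (a \<in> Q) \<noteq> (b \<in> Q) \<longrightarrow> bd x Q)"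
    and small: "\<And>Q. Q \<subseteq> P \<Longrightarrow> card {x \<in> M. bd x Q} \<le> k"
    and empty: "\<And>x. x \<in> M \<Longrightarrow> \<not> bd x {}"
  shows "card M \<le> 2 * k - 1"
proof -
  let ?S = "Pow P"
  have fin: "finite ?S" using assms(1) by simp
  have "card M * 2 ^ card P = (\<Sum>x\<in>M. 2 ^ card P)" by simp
  also have "\<dots> \<le> (\<Sum>x\<in>M. 2 * card {Q \<in> ?S. bd x Q})"
  proof (rule sum_mono)
    fix x assume "x \<in> M"
    then obtain a b where "a \<in> P" "a \<noteq> b" "\<forall>Q\<subseteq>P. (a \<in> Q) \<noteq> (b \<in> Q) \<longrightarrow> bd x Q" using sep by blast
    then show "2 ^ card P \<le> 2 * card {Q \<in> ?S. bd x Q}"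
      using half_of_subsets[OF assms(1), of a b "bd x"] by blast
  qed
  also have "\<dots> = 2 * (\<Sum>x\<in>M. \<Sum>Q\<in>?S. of_bool (bd x Q))"
    using fin by (simp add: sum_distrib_left Int_def)
  also have "(\<Sum>x\<in>M. \<Sum>Q\<in>?S. of_bool (bd x Q)) = (\<Sum>Q\<in>?S. \<Sum>x\<in>M. of_bool (bd x Q) :: nat)"
    by (rule sum.swap)
  also have "\<dots> = (\<Sum>Q\<in>?S. card {x \<in> M. bd x Q})"
    using assms(2) by (simp add: Int_def)
  also have "\<dots> = (\<Sum>Q\<in>?S - {{}}. card {x \<in> M. bd x Q})"
  proof (rule sum.mono_neutral_right[OF fin])
    have "card {x \<in> M. bd x {}} = 0" using empty by (metis (no_types, lifting) Collect_empty_eq card.empty)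
    moreover have "?S - (?S - {{}}) = {{}}" by auto
    ultimately show "\<forall>Q\<in>?S - (?S - {{}}). card {x \<in> M. bd x Q} = 0" by simp
  qed auto
  also have "\<dots> \<le> (\<Sum>Q\<in>?S - {{}}. k)"
    by (rule sum_mono) (use small in auto)
  also have "\<dots> = k * (2 ^ card P - 1)"
    using assms(1) by (simp add: card_Pow)
  finally have le: "card M * 2 ^ card P \<le> 2 * (k * (2 ^ card P - 1))" by simp
  show ?thesis
  proof (cases "k = 0")
    \<comment> \<open>For \<open>k = 0\<close> truncated subtraction makes the bound 0, and the
      inequality just derived forces \<open>M\<close> to be empty.\<close>
    case True
    then show ?thesis using le by simp
  next
    case False
    have "2 * (k * (2 ^ card P - 1)) < 2 * k * 2 ^ card P" using False by simp
    with le have "card M * 2 ^ card P < 2 * k * 2 ^ card P" by (rule le_less_trans)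
    then have "card M < 2 * k" by simp
    then show ?thesis by simp
  qed
qed

section \<open>A rooted forest from a decomposition\<close>

text \<open>The numbering \<open>idx\<close> breaks ties among vertices placed at the same node.
  Walk lengths count nodes, so \<open>k + 1\<close> stands for distance \<open>k\<close>.\<close>

locale graph_decomposition = centred_tree V F c
  for V :: "'n set" and F :: "'n set set" and c :: 'n +
  fixes G :: "('v, 'e) mgraph" and \<sigma> :: "'e \<Rightarrow> 'n" and k :: nat and idx :: "'v \<Rightarrow> nat"
  assumes graph: "finite_mgraph G"
    and c_internal: "c \<notin> leaves V F"
    and sigma: "bij_betw \<sigma> (edges G) (leaves V F)"
    and near: "l \<in> leaves V F \<Longrightarrow> \<exists>p. walk V F p \<and> hd p = c \<and> last p = l \<and> length p \<le> k + 1"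
    and width: "v \<in> V - leaves V F \<Longrightarrow> Q \<subseteq> node_partition (edges G) V F \<sigma> v \<Longrightarrow>
      graph_connectivity G (\<Union>Q) \<le> int k"
    and idx: "inj_on idx (verts G)"
begin

definition at where "at x = {e \<in> edges G. x \<in> ends G e}"

text \<open>A vertex without edges determines no place in the tree; such vertices get no ancestors
  and become trees of their own.\<close>

definition X where "X = {x \<in> verts G. at x \<noteq> {}}"

definition place where "place x = lca (\<sigma> ` at x)"

text \<open>
  A leaf is fat if it is the place of both ends of an isolated edge. These two vertices form a
  component of their own, which must not be put below the vertices placed above the leaf.
\<close>

definition fat where "fat n \<longleftrightarrow> n \<in> leaves V F \<and> 2 \<le> card {x \<in> X. place x = n}"

text \<open>Lexicographic: by place, then by \<open>idx\<close>. The condition on \<open>fat\<close>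
  detaches the two ends of an isolated edge, which would otherwise lie below up to
  \<open>k * (2 * k - 1)\<close> vertices and exceed the bound by one.\<close>

definition anc where
  "anc x = (if x \<in> X then {y \<in> X. place y \<noteq> place x \<and> dom (place y) (place x) \<and> \<not> fat (place x) \<or>
     place y = place x \<and> idx y < idx x} else {})"

lemma finite_X: "finite X"
  using graph by (simp add: X_def finite_mgraph_def)

lemma finite_nodes: "finite V"
  using tree by (simp add: tree_def forest_def simple_graph_def)

lemma sigma_leaf: "e \<in> edges G \<Longrightarrow> \<sigma> e \<in> leaves V F"
  using sigma by (auto simp: bij_betw_def)

lemma sigma_V: "e \<in> edges G \<Longrightarrow> \<sigma> e \<in> V"
  using sigma_leaf by (auto simp: leaves_def)

lemma sigma_inj: "e \<in> edges G \<Longrightarrow> f \<in> edges G \<Longrightarrow> \<sigma> e = \<sigma> f \<Longrightarrow> e = f"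
  using sigma by (auto simp: bij_betw_def inj_on_def)

lemma at_image:
  assumes "x \<in> X"
  shows "\<sigma> ` at x \<noteq> {}" "\<sigma> ` at x \<subseteq> V"
  using assms sigma_V by (auto simp: X_def at_def)

lemma place_in: "x \<in> X \<Longrightarrow> place x \<in> V"
  unfolding place_def by (rule lca(1)[OF at_image])

lemma place_dom: "x \<in> X \<Longrightarrow> e \<in> at x \<Longrightarrow> dom (place x) (\<sigma> e)"
  unfolding place_def by (rule lca(2)[OF at_image]) simp_all

text \<open>A leaf other than \<open>c\<close> dominates only itself, so every edge at
  \<open>x\<close> is mapped to it; by injectivity there is just one.\<close>

lemma place_leaf:
  assumes "x \<in> X" "place x \<in> leaves V F" "e \<in> at x"
  shows "place x = \<sigma> e" "at x = {e}"
proof -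
  have "place x \<noteq> c" using assms(2) c_internal by auto
  then have eq: "\<sigma> f = place x" if "f \<in> at x" for f
    using leaf_dom[OF assms(2) _ _ place_dom[OF assms(1) that]] that sigma_V by (auto simp: at_def)
  show "place x = \<sigma> e" using eq assms(3) by simp
  have "f = e" if "f \<in> at x" for f
    using eq[OF that] eq[OF assms(3)] sigma_inj[of f e] that assms(3) by (simp add: at_def)
  then show "at x = {e}" using assms(3) by blast
qed

lemma X_at:
  assumes "x \<in> X" obtains e where "e \<in> at x" "e \<in> edges G" "x \<in> ends G e"
  using assms by (auto simp: X_def at_def)

text \<open>By \<open>lca_separates\<close>, a vertex placed at \<open>d\<close> has edges in two
  different parts at \<open>d\<close>. Any union that contains exactly one of these parts has the
  vertex on its boundary, so the counting lemma applies.\<close>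

lemma card_place_internal:
  assumes d: "d \<in> V - leaves V F"
  shows "card {x \<in> X. place x = d} \<le> 2 * k - 1"
proof -
  let ?P = "node_partition (edges G) V F \<sigma> d"
  let ?J = "joined (V - {d}) {e \<in> F. d \<notin> e}"
  let ?B = "\<lambda>Q x. (\<exists>e\<in>\<Union>Q. x \<in> ends G e) \<and> (\<exists>e\<in>edges G - \<Union>Q. x \<in> ends G e)"
  let ?part = "\<lambda>e. {f \<in> edges G. ?J (\<sigma> e) (\<sigma> f)}"
  have Ve: "\<sigma> e \<in> V - {d}" if "e \<in> edges G" for e
    using sigma_V[OF that] sigma_leaf[OF that] d by auto
  have part_in: "?part e \<in> ?P" if "e \<in> edges G" for e
    unfolding node_partition_def components_def using Ve[OF that] by auto
  have part_self: "e \<in> ?part e" if "e \<in> edges G" for e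
    using that Ve[OF that] by (simp add: joined_refl)
  have part_eq: "Y = ?part e" if YP: "Y \<in> ?P" and eY: "e \<in> Y" for Y e
  proof -
    obtain u where Y: "Y = {f \<in> edges G. ?J u (\<sigma> f)}"
      using YP unfolding node_partition_def components_def by auto
    then have "?J u (\<sigma> e)" using eY by simp
    then have "?J u w \<longleftrightarrow> ?J (\<sigma> e) w" for w
      using joined_trans[of _ _ u "\<sigma> e" w] joined_trans[OF joined_sym, of _ _ u "\<sigma> e" w] by blast
    then show ?thesis using Y by simp
  qed
  show ?thesis
  proof (rule card_separated_le[where P = ?P and bd = "\<lambda>x Q. ?B Q x"])
    show "finite ?P" unfolding node_partition_def components_def using finite_nodes by auto
    show "finite {x \<in> X. place x = d}" using finite_X by simp
    show "\<not> ?B {} x" for x by simp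
    show "card {x \<in> {x \<in> X. place x = d}. ?B Q x} \<le> k" if Q: "Q \<subseteq> ?P" for Q
    proof -
      have "finite (verts G)" using graph by (simp add: finite_mgraph_def)
      then have "card {x \<in> {x \<in> X. place x = d}. ?B Q x} \<le> card {x \<in> verts G. ?B Q x}"
        by (intro card_mono) (auto simp: X_def)
      then show ?thesis using width[OF d Q] by (simp add: graph_connectivity_def)
    qed
    fix x assume x: "x \<in> {x \<in> X. place x = d}"
    then have "lca (\<sigma> ` at x) = d" by (simp add: place_def)
    moreover have "d \<notin> \<sigma> ` at x" using d sigma_leaf by (auto simp: at_def)
    ultimately obtain e f where ef: "e \<in> at x" "f \<in> at x" "\<not> ?J (\<sigma> e) (\<sigma> f)"
      using lca_separates[OF at_image, of x] x by auto
    have E: "e \<in> edges G" "f \<in> edges G" "x \<in> ends G e" "x \<in> ends G f" using ef by (auto simp: at_def)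
    have neq: "?part e \<noteq> ?part f" using part_self[OF E(2)] ef(3) by blast
    have bd: "?B Q x" if "Q \<subseteq> ?P" "?part e \<in> Q" "?part f \<notin> Q" "e \<in> edges G" "f \<in> edges G"
      "x \<in> ends G e" "x \<in> ends G f" for Q e f
    proof -
      have "e \<in> \<Union>Q" using that(2) part_self[OF that(4)] by (rule UnionI)
      moreover have "f \<notin> \<Union>Q"
      proof
        assume "f \<in> \<Union>Q"
        then obtain Y where "Y \<in> Q" "f \<in> Y" by (rule UnionE)
        then show False using part_eq[of Y f] that(1,3) by auto
      qed
      ultimately show ?thesis using that(5-7) by (intro conjI bexI[of _ e] bexI[of _ f]) auto
    qed
    show "\<exists>a\<in>?P. \<exists>b. a \<noteq> b \<and> (\<forall>Q\<subseteq>?P. (a \<in> Q) \<noteq> (b \<in> Q) \<longrightarrow> ?B Q x)"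
    proof (intro bexI[OF _ part_in[OF E(1)]] exI[of _ "?part f"] conjI allI impI)
      show "?part e \<noteq> ?part f" by (rule neq)
      fix Q assume Q: "Q \<subseteq> ?P" and sep: "(?part e \<in> Q) \<noteq> (?part f \<in> Q)"
      have "?B Q x"
        by (cases "?part e \<in> Q") (use sep bd[OF Q, of e f] bd[OF Q, of f e] E in \<open>simp_all only: simp_thms\<close>)
      then show "\<exists>e\<in>\<Union>Q. x \<in> ends G e" "\<exists>e\<in>edges G - \<Union>Q. x \<in> ends G e" by simp_all
    qed
  qed
qed

lemma card_fat_leaf:
  assumes "x \<in> X" "place x \<in> leaves V F" "e \<in> at x"
  shows "{y \<in> X. place y = place x} \<subseteq> ends G e" "card (ends G e) \<le> 2" "finite (ends G e)"
proof -
  have e: "e \<in> edges G" using assms(3) by (simp add: at_def)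
  show "card (ends G e) \<le> 2" using graph e by (auto simp: finite_mgraph_def)
  show "finite (ends G e)" using graph e unfolding finite_mgraph_def by (metis finite_subset)
  show "{y \<in> X. place y = place x} \<subseteq> ends G e"
  proof
    fix y assume y: "y \<in> {y \<in> X. place y = place x}"
    then obtain f where f: "f \<in> at y" "f \<in> edges G" "y \<in> ends G f" using X_at by blast
    have "place y = \<sigma> f" using place_leaf[of y f] y f assms(2) by simp
    moreover have "place x = \<sigma> e" using place_leaf[OF assms] by simp
    ultimately have "f = e" using sigma_inj f(2) e y by simp
    then show "y \<in> ends G e" using f by simp
  qed
qed

lemma place_above_internal:
  assumes "x \<in> X" "y \<in> X" "place y \<noteq> place x" "dom (place y) (place x)"
  shows "place y \<notin> leaves V F"
proof
  assume leaf: "place y \<in> leaves V F"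
  then have "place y \<noteq> c" using c_internal by auto
  then show False using leaf_dom[OF leaf _ place_in[OF assms(1)] assms(4)] assms(3) by simp
qed

section \<open>The ancestor order by place and the number of ancestors\<close>

sublocale tree_order "verts G" anc
proof
  show "finite (verts G)" using graph by (simp add: finite_mgraph_def)
  show "anc x \<subseteq> verts G" for x by (auto simp: anc_def X_def)
  show "x \<notin> anc x" for x by (auto simp: anc_def)
  fix x y assume y: "y \<in> anc x"
  then have X: "x \<in> X" "y \<in> X" by (auto simp: anc_def split: if_splits)
  show "anc y \<subseteq> anc x"
  proof
    fix z assume z: "z \<in> anc y"
    then have "z \<in> X" by (auto simp: anc_def split: if_splits)
    have "place z \<noteq> place x" if "dom (place z) (place y)" "dom (place y) (place x)" "place y \<noteq> place x"
      using dom_antisym[of "place y" "place x"] that place_in[OF X(2)] by auto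
    then show "z \<in> anc x"
      using y z X \<open>z \<in> X\<close> dom_trans[of "place z" "place y" "place x"] by (auto simp: anc_def)
  qed
  fix z assume z: "z \<in> anc x"
  then have Z: "z \<in> X" by (auto simp: anc_def split: if_splits)
  have tot: "y = z \<or> idx y < idx z \<or> idx z < idx y"
    using idx X Z by (auto simp: X_def inj_on_def)
  \<comment> \<open>A place strictly above another is internal, so the exception for fat places
    never makes two ancestors incomparable.\<close>
  have nf: "\<not> fat (place w)" if "w \<in> X" "dom (place w) (place x)" "place w \<noteq> place x" for w
    using place_above_internal[OF X(1) that(1,3,2)] by (simp add: fat_def)
  have "dom (place y) (place z) \<or> dom (place z) (place y)"
    using dom_chain[OF place_in[OF X(1)], of "place y" "place z"] y z X Z dom_refl
    by (auto simp: anc_def)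
  then show "y = z \<or> y \<in> anc z \<or> z \<in> anc y"
    using y z X Z tot nf[of y] nf[of z] by (cases "place y = place z") (auto simp: anc_def)
qed

text \<open>At a fat leaf the only possible ancestor is the other end of the edge, whence the 1.
  Otherwise all ancestors are placed at internal nodes on the way from \<open>c\<close> to an edge
  at \<open>x\<close>.\<close>

lemma card_anc_le: "card (anc x) \<le> max (k * (2 * k - 1)) 1"
proof (cases "x \<in> X")
  case False
  then show ?thesis by (simp add: anc_def)
next
  case x: True
  then obtain e where e: "e \<in> at x" "e \<in> edges G" "x \<in> ends G e" using X_at by blast
  show ?thesis
  proof (cases "fat (place x)")
    case True
    then have leaf: "place x \<in> leaves V F" by (simp add: fat_def)
    note C = card_fat_leaf[OF x leaf e(1)]
    have "anc x \<subseteq> ends G e - {x}" using C(1) x True by (auto simp: anc_def)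
    then have "card (anc x) \<le> card (ends G e - {x})" using C(3) by (intro card_mono) auto
    also have "\<dots> \<le> 1" using C e(3) by (simp add: card_Diff_singleton)
    finally show ?thesis by simp
  next
    case False
    let ?D = "{d \<in> V - leaves V F. dom d (\<sigma> e)}"
    have sub: "anc x \<subseteq> (\<Union>d\<in>?D. {y \<in> X. place y = d})"
    proof
      fix y assume y: "y \<in> anc x"
      then have Y: "y \<in> X" "place y = place x \<or> dom (place y) (place x)" "y \<noteq> x"
        using x by (auto simp: anc_def)
      have "dom (place y) (\<sigma> e)"
        using Y(2) place_dom[OF x e(1)] dom_trans by metis
      \<comment> \<open>A leaf shared by \<open>x\<close> and \<open>y\<close> would be fat.\<close>
      moreover have "place y \<notin> leaves V F"
      proof (cases "place y = place x")
        case True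
        have "card {x, y} \<le> card {y \<in> X. place y = place x}"
          using x Y True finite_X by (intro card_mono) auto
        then show ?thesis using False True Y(3) by (auto simp: fat_def)
      next
        case neq: False
        then show ?thesis using place_above_internal[OF x Y(1)] Y(2) by auto
      qed
      ultimately show "y \<in> (\<Union>d\<in>?D. {y \<in> X. place y = d})"
        using Y(1) place_in[OF Y(1)] by auto
    qed
    obtain p where p: "walk V F p" "hd p = c" "last p = \<sigma> e" "length p \<le> k + 1"
      using near[OF sigma_leaf[OF e(2)]] by blast
    have "p \<noteq> []" using p(1) by (simp add: walk_def)
    then have "\<sigma> e \<in> set p" using p(3) last_in_set by metis
    \<comment> \<open>Dominators of \<open>\<sigma> e\<close> lie on every walk to it. Of the at
      most \<open>k + 1\<close> nodes of \<open>p\<close> one is the leaf \<open>\<sigma> e\<close>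
      itself, which leaves \<open>k\<close>.\<close>
    have "?D \<subseteq> set p - {\<sigma> e}"
      using domD[OF _ p(1-3)] sigma_leaf[OF e(2)] by auto
    then have "card ?D \<le> card (set p - {\<sigma> e})" by (intro card_mono) auto
    also have "\<dots> = card (set p) - 1" using \<open>\<sigma> e \<in> set p\<close> by simp
    also have "\<dots> \<le> k" using card_length[of p] p(4) by simp
    finally have D: "card ?D \<le> k" .
    have "finite ?D" using finite_nodes by simp
    have "card (anc x) \<le> card (\<Union>d\<in>?D. {y \<in> X. place y = d})"
      using sub finite_X \<open>finite ?D\<close> by (intro card_mono) auto
    also have "\<dots> \<le> (\<Sum>d\<in>?D. card {y \<in> X. place y = d})"
      by (rule card_UN_le[OF \<open>finite ?D\<close>])
    also have "\<dots> \<le> card ?D * (2 * k - 1)"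
      using sum_bounded_above[of ?D "\<lambda>d. card {y \<in> X. place y = d}" "2 * k - 1"] card_place_internal
      by simp
    also have "\<dots> \<le> k * (2 * k - 1)" using D by (rule mult_le_mono1)
    finally show ?thesis by simp
  qed
qed

text \<open>The places of two adjacent vertices both dominate the leaf of their edge, hence are
  comparable.\<close>

lemma tree_depth_le: "graph_tree_depth G \<le> Suc (max (k * (2 * k - 1)) 1)"
  unfolding graph_tree_depth_def
proof (rule simple_tree_depth_le)
  show "card (anc x) < Suc (max (k * (2 * k - 1)) 1)" for x
    using card_anc_le by (simp add: less_Suc_eq_le)
  fix D assume "D \<in> simplification_edges G"
  then obtain e where e: "e \<in> edges G" "D = ends G e" "card (ends G e) = 2"
    by (auto simp: simplification_edges_def)
  then obtain u v where uv: "ends G e = {u, v}" "u \<noteq> v" by (auto simp: card_2_iff)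
  have "ends G e \<subseteq> verts G" using graph e(1) by (simp add: finite_mgraph_def)
  then have X: "u \<in> X" "v \<in> X" and at: "e \<in> at u" "e \<in> at v"
    using e(1) uv(1) by (auto simp: X_def at_def)
  have below: "u \<in> anc v" if "dom (place u) (place v)" "place u \<noteq> place v"
    "u \<in> X" "v \<in> X" "e \<in> at v" "ends G e = {u, v}" for u v
  proof -
    \<comment> \<open>All vertices placed at a fat leaf are ends of one edge, so there are exactly
      two. Both ends of \<open>e\<close> would be placed there, against
      \<open>place u \<noteq> place v\<close>.\<close>
    have "\<not> fat (place v)"
    proof
      assume fat: "fat (place v)"
      then have leaf: "place v \<in> leaves V F" by (simp add: fat_def)
      note C = card_fat_leaf[OF that(4) leaf that(5)]
      have "{y \<in> X. place y = place v} = ends G e"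
        using fat C by (intro card_seteq) (auto simp: fat_def)
      then show False using that(2,6) by blast
    qed
    then show ?thesis using that by (simp add: anc_def)
  qed
  have "u \<in> anc v \<or> v \<in> anc u"
  proof (cases "place u = place v")
    case True
    have "idx u \<noteq> idx v" using idx X uv(2) by (auto simp: X_def inj_on_def)
    then show ?thesis using True X by (auto simp: anc_def)
  next
    case False
    have "dom (place u) (place v) \<or> dom (place v) (place u)"
      using dom_chain[OF sigma_V[OF e(1)]] place_dom X at by blast
    then show ?thesis
      using below[of u v] below[of v u] False X at uv by (auto simp: insert_commute)
  qed
  moreover have "u \<in> verts G" "v \<in> verts G" using X by (auto simp: X_def)
  ultimately show "\<exists>x\<in>verts G. \<exists>y\<in>anc x. D = {y, x}"
    using e(2) uv(1) by (metis insert_commute)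
qed

end

lemma tree_depth_from_decomposition:
  fixes G :: "('v, 'e) mgraph"
  assumes G: "finite_mgraph G"
    and kr: "kr_decomposition (edges G) (graph_connectivity G) k k V F \<sigma>"
  shows "graph_tree_depth G \<le> Suc (max (k * (2 * k - 1)) 1)"
proof -
  have tree: "tree V F" and int: "internal_nodes V F \<noteq> {}" and \<sigma>: "bij_betw \<sigma> (edges G) (leaves V F)"
    and w: "width (edges G) (graph_connectivity G) V F \<sigma> \<le> int k" and rad: "radius V F \<le> k"
    using kr by (auto simp: kr_decomposition_def decomposition_def)
  have finV: "finite V" using tree by (simp add: tree_def forest_def simple_graph_def)
  obtain c where c: "c \<in> internal_nodes V F"
    "\<And>l. l \<in> leaves V F \<Longrightarrow> \<exists>p. walk V F p \<and> hd p = c \<and> last p = l \<and> length p \<le> radius V F + 1"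
    using internal_centre[OF tree int] by blast
  have near: "\<exists>p. walk V F p \<and> hd p = c \<and> last p = l \<and> length p \<le> k + 1" if l: "l \<in> leaves V F" for l
  proof -
    obtain p where "walk V F p" "hd p = c" "last p = l" "length p \<le> radius V F + 1"
      using c(2)[OF l] by blast
    then show ?thesis using rad by (intro exI[of _ p]) simp
  qed
  have width: "graph_connectivity G (\<Union>Q) \<le> int k"
    if v: "v \<in> V - leaves V F" and Q: "Q \<subseteq> node_partition (edges G) V F \<sigma> v" for v Q
  proof -
    have "finite (node_partition (edges G) V F \<sigma> v)"
      unfolding node_partition_def components_def using finV by auto
    then have "graph_connectivity G (\<Union>Q) \<le> node_width (edges G) (graph_connectivity G) V F \<sigma> v"
      unfolding node_width_def using Q by (intro Max_ge) auto
    also have "\<dots> \<le> width (edges G) (graph_connectivity G) V F \<sigma>"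
      unfolding width_def using v finV by (intro Max_ge) (auto simp: internal_nodes_def)
    finally show ?thesis using w by simp
  qed
  have "finite (verts G)" using G by (simp add: finite_mgraph_def)
  then obtain idx :: "'v \<Rightarrow> nat" where idx: "inj_on idx (verts G)"
    using finite_imp_inj_to_nat_seg by metis
  interpret graph_decomposition V F c G \<sigma> k idx
  proof
    show "c \<in> V" "c \<notin> leaves V F" using c(1) by (auto simp: internal_nodes_def)
  qed (fact tree G \<sigma> near width idx)+
  show ?thesis by (rule tree_depth_le)
qed

text \<open>Here branch-depth is 0 by convention and no decomposition is at hand. The ends of the
  only edge are ordered by \<open>idx\<close>; all other vertices stay isolated.\<close>

lemma tree_depth_few_edges:
  assumes G: "finite_mgraph G" and E: "card (edges G) < 2"
  shows "graph_tree_depth G \<le> 2"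
proof -
  have "finite (verts G)" "finite (edges G)" using G by (simp_all add: finite_mgraph_def)
  then obtain idx :: "'a \<Rightarrow> nat" where idx: "inj_on idx (verts G)"
    using finite_imp_inj_to_nat_seg by metis
  have same: "e = f" if "e \<in> edges G" "f \<in> edges G" for e f
    using E \<open>finite (edges G)\<close> that card_le_Suc0_iff_eq[of "edges G"] by (simp add: less_2_cases_iff) auto
  have ends: "ends G e \<subseteq> verts G \<and> card (ends G e) \<le> 2 \<and> finite (ends G e)" if "e \<in> edges G" for e
    using G that unfolding finite_mgraph_def by (auto intro: finite_subset)
  let ?anc = "\<lambda>x. {y. \<exists>e\<in>edges G. y \<in> ends G e \<and> x \<in> ends G e \<and> idx y < idx x}"
  interpret tree_order "verts G" ?anc
  proof
    show "finite (verts G)" by fact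
    show "?anc x \<subseteq> verts G" for x using ends by auto
    show "x \<notin> ?anc x" for x by simp
    show "?anc y \<subseteq> ?anc x" if "y \<in> ?anc x" for x y
      using that same by (auto intro: order_less_trans)
    show "y = z \<or> y \<in> ?anc z \<or> z \<in> ?anc y" if yz: "y \<in> ?anc x" "z \<in> ?anc x" for x y z
    proof -
      obtain e where "e \<in> edges G" "y \<in> ends G e" "z \<in> ends G e" using yz same by blast
      moreover have "y = z \<or> idx y < idx z \<or> idx z < idx y"
        using calculation ends idx by (meson inj_onD linorder_neqE_nat subsetD)
      ultimately show ?thesis by auto
    qed
  qed
  show ?thesis
    unfolding graph_tree_depth_def
  proof (rule simple_tree_depth_le)
    show "card (?anc x) < 2" for x
    proof (cases "\<exists>e\<in>edges G. x \<in> ends G e")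
      case True
      then obtain e where e: "e \<in> edges G" "x \<in> ends G e" by blast
      have "?anc x \<subseteq> ends G e - {x}" using same e by auto
      then have "card (?anc x) \<le> card (ends G e - {x})" using ends[OF e(1)] by (intro card_mono) auto
      moreover have "card (ends G e - {x}) < 2"
        using ends[OF e(1)] card_Diff1_less[of "ends G e" x] e(2) by linarith
      ultimately show ?thesis by (rule le_less_trans)
    next
      case False
      then have "?anc x = {}" by blast
      then show ?thesis by (simp only: card.empty)
    qed
    fix D assume "D \<in> simplification_edges G"
    then obtain e u v where e: "e \<in> edges G" "D = {u, v}" "ends G e = {u, v}" "u \<noteq> v"
      by (auto simp: simplification_edges_def card_2_iff)
    then have "u \<in> verts G" "v \<in> verts G" using ends by auto
    moreover from this have "idx u < idx v \<or> idx v < idx u"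
      using idx e(4) by (meson inj_onD linorder_neqE_nat)
    ultimately show "\<exists>x\<in>verts G. \<exists>y\<in>?anc x. D = {y, x}"
      using e by (auto simp: insert_commute)
  qed
qed

theorem theorem3p5:
  fixes G :: "('v, 'e) mgraph" and k t :: nat
  assumes "finite_mgraph G"
    and "k = graph_branch_depth G"
    and "t = graph_tree_depth G"
  shows "int k - 1 \<le> int t \<and> int t \<le> max (2 * (int k)\<^sup>2 - int k + 1) 2"
proof (cases "card (edges G) < 2")
  case True
  then have "k = 0" using assms(2) by (simp add: graph_branch_depth_def branch_depth_def)
  then show ?thesis using tree_depth_few_edges[OF assms(1) True] assms(3) by simp
next
  case False
  let ?kr = "\<lambda>k. \<exists>(V :: nat set) F \<sigma>. kr_decomposition (edges G) (graph_connectivity G) k k V F \<sigma>"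
  have k: "k = (LEAST k. ?kr k)"
    using False assms(2) by (simp add: graph_branch_depth_def branch_depth_def)
  have t: "?kr (t + 1)" using decomposition_from_tree_depth[OF assms(1)] False assms(3) by simp
  then have lower: "k \<le> t + 1" unfolding k by (rule Least_le)
  \<comment> \<open>The decomposition built for the lower bound also shows that the minimum defining
    the branch-depth is attained.\<close>
  have "?kr k" unfolding k using t by (rule LeastI)
  then have "t \<le> Suc (max (k * (2 * k - 1)) 1)"
    using tree_depth_from_decomposition[OF assms(1)] assms(3) by blast
  then have "int t \<le> max (int (k * (2 * k - 1)) + 1) 2" by linarith
  \<comment> \<open>Truncated subtraction is harmless: for \<open>k = 0\<close> the factor
    \<open>k\<close> annihilates it.\<close>
  moreover have "int (k * (2 * k - 1)) = 2 * (int k)\<^sup>2 - int k"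
    by (cases k) (auto simp: power2_eq_square algebra_simps)
  ultimately show ?thesis using lower by simp
qed

end
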